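(* Let $u$ be the solution of the parabolic problem $\partial_t u+\mathcal{L}u=f$ in $\Omega\times(0,T]$, $u(\cdot,0)=u^0$, $u=0$ on $\partial\Omega\times[0,T]$, and let the Green's function bounds (with constants $\kappa_0,\gamma$) stated in the context hold. Let $0=t_0<t_1<\dots<t_M=T$ be an arbitrary mesh and let $U^j\in H_0^1(\Omega)$ be the backward Euler approximations: $U^0=u^0$ and $$\delta_t U^j+\mathcal{L}U^j=f^j\quad\text{in }\Omega,\qquad j=1,\dots,M.$$ Set $\delta_tU^0:=f^0-\mathcal{L}U^0$ and $\delta_t^2U^j:=\dfrac{\delta_tU^j-\delta_tU^{j-1}}{\tau_j}$, $j=1,\dots,M$. Then $$\|u(T)-U^M\|_{\infty,\Omega}\le\sum_{j=1}^M\mathrm{e}^{-\gamma(T-t_j)}\left(\eta_{\hat f}^j+\eta_{\delta^2U}^j\right)$$ with $$\eta_{\hat f}^j:=\kappa_0\int_{I_j}\|(f-\hat f)(s)\|_{\infty,\Omega}\,\mathrm{d}s,\qquad \eta_{\delta^2U}^j:=\frac{\kappa_0\tau_j^2}{2}\|\delta_t^2U^j\|_{\infty,\Omega}.$$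
   Context: Setting. $\Omega\subset\mathbb{R}^n$ is a spatial domain with Lipschitz boundary, $T>0$, $\mathcal{L}$ is a second-order linear elliptic operator in $\Omega$ with adjoint $\mathcal{L}^*$, $f\colon[0,T]\to L_2(\Omega)$, and $\mathcal{K}w:=\partial_t w+\mathcal{L}w$. For functions $w$ on $\Omega\times[0,T]$ write $w(t):=w(\cdot,t)$. $\|\cdot\|_{p,\Omega}$, $p\in[1,\infty]$, is the norm of $L_p(\Omega)$, and $\langle\cdot,\cdot\rangle$ denotes both the duality pairing on $H^{-1}(\Omega)\times H_0^1(\Omega)$ and the $L_2(\Omega)$ scalar product. Green's function. For fixed $x\in\Omega$, $\mathcal{G}$ solves $\partial_t\mathcal{G}+\mathcal{L}^*\mathcal{G}=0$ in $\Omega\times\mathbb{R}^+$, $\mathcal{G}|_{\partial\Omega}=0$, $\mathcal{G}(0)=\delta_x$ (Dirac distribution at $x$). For all $w\in W^{1,1}([0,T],H_0^1(\Omega))$ and $t\in(0,T]$ one has $w(x,t)=\langle\mathcal{G}(t),w(0)\rangle+\int_0^t\langle\mathcal{G}(t-s),(\mathcal{K}w)(s)\rangle\,\mathrm{d}s$; the solution $u$ is assumed regular enough that this representation applies to $u$ minus a continuous function that is piecewise polynomial in time and built from the discrete approximations. Standing assumption. There are non-negative constants $\kappa_0,\kappa_1,\kappa_2,\kappa_1',\kappa_2',\gamma$ such that, with $\kappa_0'=0$, $\|\partial_t^p\mathcal{G}(t)\|_{1,\Omega}\le\left(\frac{\kappa_p}{t^p}+\kappa_p'\right)\mathrm{e}^{-\gamma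 t}$ for all $x\in\bar\Omega$, $t\in[0,T]$, $p=0,1,2$. Mesh notation. $I_j:=(t_{j-1},t_j)$, $\tau_j:=t_j-t_{j-1}$; $f^j:=f(t_j)$; for $j\ge1$, $\delta_t v^j:=(v^j-v^{j-1})/\tau_j$. $\hat f$ is the piecewise linear interpolant in time of $f$ on the mesh: $\hat f(s)=f^j-(t_j-s)\,\delta_tf^j$ for $s\in[t_{j-1},t_j]$. *)

theory Defs
  imports
    "HOL-Analysis.Analysis"
    "HOL-Probability.Essential_Supremum"
    "HOL-Computational_Algebra.Polynomial"
begin

text \<open>
  Functions on \<open>\<Omega>\<close> are total functions \<open>real^'n \<Rightarrow> real\<close>, considered up to equality almost
  everywhere in \<open>\<Omega>\<close>; a time-dependent function \<open>w\<close> on \<open>\<Omega> \<times> [0,T]\<close> is written \<open>w t x\<close>.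
  Elements of \<open>H\<^sup>-\<^sup>1(\<Omega>)\<close> are functionals on functions, only their values on \<open>H01 \<Omega>\<close> being
  relevant.
\<close>


section \<open>The domain\<close>

text \<open>
  Near each boundary point, and after choosing a suitable "vertical" unit vector \<open>e\<close>, the set is
  the strict epigraph of a Lipschitz function of the component orthogonal to \<open>e\<close>.  Boundedness is
  not required.
\<close>

definition lipschitz_boundary :: "(real^'n) set \<Rightarrow> bool" where
  "lipschitz_boundary \<Omega> \<longleftrightarrow>
     (\<forall>p\<in>frontier \<Omega>. \<exists>r>0. \<exists>e. norm e = 1 \<and>
        (\<exists>C h. C-lipschitz_on UNIV (h :: real^'n \<Rightarrow> real) \<and>
           \<Omega> \<inter> ball p r = {x \<in> ball p r. h (x - (x \<bullet> e) *\<^sub>R e) < x \<bullet> e}))"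

definition lipschitz_domain :: "(real^'n) set \<Rightarrow> bool" where
  "lipschitz_domain \<Omega> \<longleftrightarrow> open \<Omega> \<and> connected \<Omega> \<and> \<Omega> \<noteq> {} \<and> lipschitz_boundary \<Omega>"


section \<open>Lebesgue spaces\<close>

definition L2 :: "(real^'n) set \<Rightarrow> (real^'n \<Rightarrow> real) set" where
  "L2 \<Omega> = {v \<in> borel_measurable (lebesgue_on \<Omega>). integrable (lebesgue_on \<Omega>) (\<lambda>x. (v x)\<^sup>2)}"

definition L2_inner :: "(real^'n) set \<Rightarrow> (real^'n \<Rightarrow> real) \<Rightarrow> (real^'n \<Rightarrow> real) \<Rightarrow> real" where
  "L2_inner \<Omega> v w = (LINT x|lebesgue_on \<Omega>. v x * w x)"

definition L1_norm :: "(real^'n) set \<Rightarrow> (real^'n \<Rightarrow> real) \<Rightarrow> ennreal" where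
  "L1_norm \<Omega> v = (\<integral>\<^sup>+x. ennreal \<bar>v x\<bar> \<partial>lebesgue_on \<Omega>)"

definition Linf_norm :: "(real^'n) set \<Rightarrow> (real^'n \<Rightarrow> real) \<Rightarrow> ennreal" where
  "Linf_norm \<Omega> v = esssup (lebesgue_on \<Omega>) (\<lambda>x. ennreal \<bar>v x\<bar>)"


section \<open>Sobolev spaces\<close>

definition partial :: "'n \<Rightarrow> (real^'n \<Rightarrow> real) \<Rightarrow> real^'n \<Rightarrow> real" where
  "partial i \<phi> x = frechet_derivative \<phi> (at x) (axis i 1)"

primrec differentiable_times :: "nat \<Rightarrow> (real^'n \<Rightarrow> real) \<Rightarrow> bool" where
  "differentiable_times 0 \<phi> \<longleftrightarrow> continuous_on UNIV \<phi>"
| "differentiable_times (Suc k) \<phi> \<longleftrightarrow>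
     \<phi> differentiable_on UNIV \<and> (\<forall>i. differentiable_times k (partial i \<phi>))"

definition test_functions :: "(real^'n) set \<Rightarrow> (real^'n \<Rightarrow> real) set" where
  "test_functions \<Omega> =
     {\<phi>. (\<forall>k. differentiable_times k \<phi>) \<and> (\<exists>K\<subseteq>\<Omega>. compact K \<and> (\<forall>x. x \<notin> K \<longrightarrow> \<phi> x = 0))}"

definition weak_gradient :: "(real^'n) set \<Rightarrow> (real^'n \<Rightarrow> real) \<Rightarrow> (real^'n \<Rightarrow> real^'n) \<Rightarrow> bool" where
  "weak_gradient \<Omega> v g \<longleftrightarrow>
     g \<in> borel_measurable (lebesgue_on \<Omega>) \<and>
     integrable (lebesgue_on \<Omega>) (\<lambda>x. (norm (g x))\<^sup>2) \<and>
     (\<forall>\<phi>\<in>test_functions \<Omega>. \<forall>i.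
        (LINT x|lebesgue_on \<Omega>. v x * partial i \<phi> x) = - (LINT x|lebesgue_on \<Omega>. g x $ i * \<phi> x))"

definition H1 :: "(real^'n) set \<Rightarrow> (real^'n \<Rightarrow> real) set" where
  "H1 \<Omega> = {v \<in> L2 \<Omega>. \<exists>g. weak_gradient \<Omega> v g}"

text \<open>For \<open>v \<in> H1 \<Omega>\<close> the choice is unique up to null sets.\<close>

definition grad :: "(real^'n) set \<Rightarrow> (real^'n \<Rightarrow> real) \<Rightarrow> real^'n \<Rightarrow> real^'n" where
  "grad \<Omega> v = (SOME g. weak_gradient \<Omega> v g)"

definition H1_norm :: "(real^'n) set \<Rightarrow> (real^'n \<Rightarrow> real) \<Rightarrow> real" where
  "H1_norm \<Omega> v =
     sqrt ((LINT x|lebesgue_on \<Omega>. (v x)\<^sup>2) + (LINT x|lebesgue_on \<Omega>. (norm (grad \<Omega> v x))\<^sup>2))"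

definition H01 :: "(real^'n) set \<Rightarrow> (real^'n \<Rightarrow> real) set" where
  "H01 \<Omega> = {v \<in> H1 \<Omega>. \<exists>\<phi>. (\<forall>k::nat. \<phi> k \<in> test_functions \<Omega>) \<and>
                             (\<lambda>k. H1_norm \<Omega> (\<lambda>x. v x - \<phi> k x)) \<longlonglongrightarrow> 0}"

type_synonym 'n functional = "(real^'n \<Rightarrow> real) \<Rightarrow> real"

definition Hm1 :: "(real^'n) set \<Rightarrow> 'n functional set" where
  "Hm1 \<Omega> = {l.
     (\<forall>v\<in>H01 \<Omega>. \<forall>w\<in>H01 \<Omega>. \<forall>a b. l (\<lambda>x. a * v x + b * w x) = a * l v + b * l w) \<and>
     (\<exists>C. \<forall>v\<in>H01 \<Omega>. \<bar>l v\<bar> \<le> C * H1_norm \<Omega> v)}"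

text \<open>
  The \<open>L\<^sub>\<infinity>\<close> norm of an element of \<open>H\<^sup>-\<^sup>1\<close>: the norm of the function representing it through the
  pairing, and \<open>\<infinity>\<close> if it is not a bounded function.  It is needed since \<open>f\<^sup>0 - L U\<^sup>0\<close> is a priori
  only an element of \<open>H\<^sup>-\<^sup>1\<close>.  If \<open>l\<close> is the \<open>L\<^sub>2\<close> product with a bounded function \<open>g \<in> L2 \<Omega>\<close>, the
  representing function is \<open>g\<close>, up to null sets.  The integrability proviso matters only for
  bounded functions that are not in \<open>L2 \<Omega>\<close>, which can occur on domains of infinite measure.
\<close>

definition Hm1_Linf_norm :: "(real^'n) set \<Rightarrow> 'n functional \<Rightarrow> ennreal" where
  "Hm1_Linf_norm \<Omega> l = Inf {Linf_norm \<Omega> g | g.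
     g \<in> borel_measurable (lebesgue_on \<Omega>) \<and>
     (\<forall>v\<in>H01 \<Omega>. integrable (lebesgue_on \<Omega>) (\<lambda>x. g x * v x) \<longrightarrow> l v = L2_inner \<Omega> g v)}"


section \<open>The elliptic operator\<close>

text \<open>
  The general second-order operator in divergence form with bounded measurable coefficients,
  \<open>L w = - div (A \<nabla>w + w d) + b \<bullet> \<nabla>w + c w\<close>.  This class is closed under taking adjoints.
\<close>

record ('n::finite) coeffs =
  Acoef :: "real^'n \<Rightarrow> real^'n^'n"
  dcoef :: "real^'n \<Rightarrow> real^'n"
  bcoef :: "real^'n \<Rightarrow> real^'n"
  ccoef :: "real^'n \<Rightarrow> real"

definition elliptic :: "(real^'n) set \<Rightarrow> 'n coeffs \<Rightarrow> bool" where
  "elliptic \<Omega> L \<longleftrightarrow>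
     Acoef L \<in> borel_measurable (lebesgue_on \<Omega>) \<and> dcoef L \<in> borel_measurable (lebesgue_on \<Omega>) \<and>
     bcoef L \<in> borel_measurable (lebesgue_on \<Omega>) \<and> ccoef L \<in> borel_measurable (lebesgue_on \<Omega>) \<and>
     (\<exists>C. AE x in lebesgue_on \<Omega>. norm (Acoef L x) \<le> C \<and> norm (dcoef L x) \<le> C \<and>
                                 norm (bcoef L x) \<le> C \<and> \<bar>ccoef L x\<bar> \<le> C) \<and>
     (\<exists>\<alpha>>0. AE x in lebesgue_on \<Omega>. \<forall>\<xi>. \<xi> \<bullet> (Acoef L x *v \<xi>) \<ge> \<alpha> * (norm \<xi>)\<^sup>2)"

definition ell_op :: "(real^'n) set \<Rightarrow> 'n coeffs \<Rightarrow> (real^'n \<Rightarrow> real) \<Rightarrow> 'n functional" where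
  "ell_op \<Omega> L w = (\<lambda>v. LINT x|lebesgue_on \<Omega>.
      (Acoef L x *v grad \<Omega> w x + w x *\<^sub>R dcoef L x) \<bullet> grad \<Omega> v x
      + (bcoef L x \<bullet> grad \<Omega> w x + ccoef L x * w x) * v x)"

definition ell_adj :: "(real^'n) set \<Rightarrow> 'n coeffs \<Rightarrow> (real^'n \<Rightarrow> real) \<Rightarrow> 'n functional" where
  "ell_adj \<Omega> L g = (\<lambda>v. ell_op \<Omega> L v g)"


section \<open>Time-dependent functions\<close>

text \<open>
  \<open>dw\<close> is the weak time derivative of \<open>w\<close>, with values in \<open>H\<^sup>-\<^sup>1\<close>, and \<open>w\<close> is the (weakly)
  continuous representative, for which point values in time make sense: for every
  \<open>v \<in> H01 \<Omega>\<close> the function \<open>t \<mapsto> \<langle>w t, v\<rangle>\<close> is absolutely continuous with derivative \<open>dw t v\<close>.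
\<close>

definition has_time_deriv ::
    "(real^'n) set \<Rightarrow> real \<Rightarrow> (real \<Rightarrow> real^'n \<Rightarrow> real) \<Rightarrow> (real \<Rightarrow> 'n functional) \<Rightarrow> bool" where
  "has_time_deriv \<Omega> T w dw \<longleftrightarrow>
     (\<forall>t\<in>{0..T}. w t \<in> L2 \<Omega>) \<and>
     (AE s in lebesgue_on {0..T}. dw s \<in> Hm1 \<Omega>) \<and>
     (\<forall>v\<in>H01 \<Omega>. set_integrable lebesgue {0..T} (\<lambda>s. dw s v) \<and>
        (\<forall>t\<in>{0..T}. L2_inner \<Omega> (w t) v = L2_inner \<Omega> (w 0) v + (LINT s:{0..t}|lebesgue. dw s v)))"

definition simple_H01 ::
    "(real^'n) set \<Rightarrow> real \<Rightarrow> (real \<Rightarrow> real^'n \<Rightarrow> real) \<Rightarrow> bool" where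
  "simple_H01 \<Omega> T S \<longleftrightarrow>
     finite (S ` {0..T}) \<and> S ` {0..T} \<subseteq> H01 \<Omega> \<and> (\<forall>y. {s\<in>{0..T}. S s = y} \<in> sets lebesgue)"

text \<open>The Bochner space \<open>L\<^sup>1(0,T;H\<^sub>0\<^sup>1(\<Omega>))\<close>.\<close>

definition L1_H01 :: "(real^'n) set \<Rightarrow> real \<Rightarrow> (real \<Rightarrow> real^'n \<Rightarrow> real) set" where
  "L1_H01 \<Omega> T = {g.
     (\<forall>s\<in>{0..T}. g s \<in> H01 \<Omega>) \<and>
     (\<exists>S. (\<forall>k::nat. simple_H01 \<Omega> T (S k)) \<and>
          (AE s in lebesgue_on {0..T}. (\<lambda>k. H1_norm \<Omega> (\<lambda>x. g s x - S k s x)) \<longlonglongrightarrow> 0)) \<and>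
     (\<integral>\<^sup>+s. ennreal (H1_norm \<Omega> (g s)) \<partial>lebesgue_on {0..T}) < \<infinity>}"

text \<open>\<open>W\<^sup>1\<^sup>,\<^sup>1([0,T],H\<^sub>0\<^sup>1(\<Omega>))\<close>, the elements being given by their continuous representatives.\<close>

definition W11_H01 :: "(real^'n) set \<Rightarrow> real \<Rightarrow> (real \<Rightarrow> real^'n \<Rightarrow> real) set" where
  "W11_H01 \<Omega> T = {w.
     (\<forall>t\<in>{0..T}. w t \<in> H01 \<Omega>) \<and>
     (\<exists>w'\<in>L1_H01 \<Omega> T. has_time_deriv \<Omega> T w (\<lambda>s. L2_inner \<Omega> (w' s)))}"

definition weak_solution ::
    "(real^'n) set \<Rightarrow> 'n coeffs \<Rightarrow> real \<Rightarrow> (real \<Rightarrow> real^'n \<Rightarrow> real) \<Rightarrow> (real^'n \<Rightarrow> real) \<Rightarrow>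
     (real \<Rightarrow> real^'n \<Rightarrow> real) \<Rightarrow> bool" where
  "weak_solution \<Omega> L T f u0 u \<longleftrightarrow>
     (\<forall>t\<in>{0..T}. u t \<in> H01 \<Omega>) \<and>
     (AE x in lebesgue_on \<Omega>. u 0 x = u0 x) \<and>
     (\<exists>du. has_time_deriv \<Omega> T u du \<and>
        (AE s in lebesgue_on {0..T}. \<forall>v\<in>H01 \<Omega>. du s v + ell_op \<Omega> L (u s) v = L2_inner \<Omega> (f s) v))"


section \<open>The Green's function\<close>

text \<open>\<open>G x t\<close> is the Green's function of the point \<open>x\<close> at time \<open>t\<close>, as a function on \<open>\<Omega>\<close>.\<close>

definition is_green ::
    "(real^'n) set \<Rightarrow> 'n coeffs \<Rightarrow> (real^'n \<Rightarrow> real \<Rightarrow> real^'n \<Rightarrow> real) \<Rightarrow> bool" where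
  "is_green \<Omega> L G \<longleftrightarrow> (\<forall>x\<in>\<Omega>.
     (\<forall>t>0. G x t \<in> H01 \<Omega>) \<and>
     (\<forall>t>0. \<forall>v\<in>H01 \<Omega>.
        ((\<lambda>t. L2_inner \<Omega> (G x t) v) has_real_derivative - ell_adj \<Omega> L (G x t) v) (at t)) \<and>
     (\<forall>\<phi>\<in>test_functions \<Omega>. ((\<lambda>t. L2_inner \<Omega> (G x t) \<phi>) \<longlongrightarrow> \<phi> x) (at_right 0)))"

text \<open>
  The representation of \<open>w\<close> by the Green's function; \<open>dw s + L (w s)\<close> is \<open>(K w)(s)\<close>, paired with
  \<open>G x (t - s) \<in> H01 \<Omega>\<close>.  As \<open>w t\<close> is determined only up to null sets, the identity is required
  for almost every \<open>x\<close>.  The weak time derivative \<open>dw\<close> is unique up to a null set of times.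
\<close>

definition green_representation ::
    "(real^'n) set \<Rightarrow> 'n coeffs \<Rightarrow> (real^'n \<Rightarrow> real \<Rightarrow> real^'n \<Rightarrow> real) \<Rightarrow> real \<Rightarrow>
     (real \<Rightarrow> real^'n \<Rightarrow> real) \<Rightarrow> bool" where
  "green_representation \<Omega> L G T w \<longleftrightarrow>
     (\<forall>dw. has_time_deriv \<Omega> T w dw \<longrightarrow>
        (\<forall>t\<in>{0<..T}. AE x in lebesgue_on \<Omega>.
           set_integrable lebesgue {0<..<t}
             (\<lambda>s. dw s (G x (t - s)) + ell_op \<Omega> L (w s) (G x (t - s))) \<and>
           w t x = L2_inner \<Omega> (G x t) (w 0) +
             (LINT s:{0<..<t}|lebesgue. dw s (G x (t - s)) + ell_op \<Omega> L (w s) (G x (t - s)))))"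

text \<open>
  \<open>D p\<close> is the \<open>p\<close>-th time derivative of \<open>G x\<close>, taken in the sense of distributions on \<open>\<Omega>\<close>.
  The time \<open>t = 0\<close> is left out, since \<open>G x\<close> is a Dirac distribution there and the bounds for
  \<open>p \<ge> 1\<close> are infinite.
\<close>

definition green_bounds ::
    "(real^'n) set \<Rightarrow> real \<Rightarrow> (real^'n \<Rightarrow> real \<Rightarrow> real^'n \<Rightarrow> real) \<Rightarrow>
     (nat \<Rightarrow> real) \<Rightarrow> (nat \<Rightarrow> real) \<Rightarrow> real \<Rightarrow> bool" where
  "green_bounds \<Omega> T G \<kappa> \<kappa>' \<gamma> \<longleftrightarrow> (\<forall>x\<in>closure \<Omega>. \<exists>D. D 0 = G x \<and>
     (\<forall>p<2. \<forall>t\<in>{0<..T}. \<forall>\<phi>\<in>test_functions \<Omega>.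
        ((\<lambda>t. L2_inner \<Omega> (D p t) \<phi>) has_real_derivative L2_inner \<Omega> (D (Suc p) t) \<phi>)
          (at t within {0<..T})) \<and>
     (\<forall>p\<le>2. \<forall>t\<in>{0<..T}.
        D p t \<in> borel_measurable (lebesgue_on \<Omega>) \<and>
        L1_norm \<Omega> (D p t) \<le> ennreal ((\<kappa> p / t ^ p + \<kappa>' p) * exp (- \<gamma> * t))))"


section \<open>Mesh and discretisation\<close>

definition is_mesh :: "real \<Rightarrow> nat \<Rightarrow> (nat \<Rightarrow> real) \<Rightarrow> bool" where
  "is_mesh T M t \<longleftrightarrow> t 0 = 0 \<and> t M = T \<and> (\<forall>j\<in>{1..M}. t (j - 1) < t j)"

definition step :: "(nat \<Rightarrow> real) \<Rightarrow> nat \<Rightarrow> real" where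
  "step t j = t j - t (j - 1)"

text \<open>\<open>delta t v j\<close> is the difference quotient, for \<open>j \<ge> 1\<close>.\<close>

definition delta ::
    "(nat \<Rightarrow> real) \<Rightarrow> (nat \<Rightarrow> real^'n \<Rightarrow> real) \<Rightarrow> nat \<Rightarrow> real^'n \<Rightarrow> real" where
  "delta t v j = (\<lambda>x. (v j x - v (j - 1) x) / step t j)"

text \<open>The piecewise linear interpolant of \<open>f\<close>, restricted to \<open>[t (j - 1), t j]\<close>.\<close>

definition fhat ::
    "(nat \<Rightarrow> real) \<Rightarrow> (real \<Rightarrow> real^'n \<Rightarrow> real) \<Rightarrow> nat \<Rightarrow> real \<Rightarrow> real^'n \<Rightarrow> real" where
  "fhat t f j s = (\<lambda>x. f (t j) x - (t j - s) * delta t (\<lambda>i. f (t i)) j x)"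

text \<open>
  \<open>\<delta>\<^sub>t U\<^sup>j\<close> and \<open>\<delta>\<^sub>t\<^sup>2 U\<^sup>j\<close> as elements of \<open>H\<^sup>-\<^sup>1\<close>, in which \<open>L\<^sub>2\<close> is embedded through the \<open>L\<^sub>2\<close> product.
\<close>

definition deltaU ::
    "(real^'n) set \<Rightarrow> 'n coeffs \<Rightarrow> (nat \<Rightarrow> real) \<Rightarrow> (real \<Rightarrow> real^'n \<Rightarrow> real) \<Rightarrow>
     (nat \<Rightarrow> real^'n \<Rightarrow> real) \<Rightarrow> nat \<Rightarrow> 'n functional" where
  "deltaU \<Omega> L t f U j =
     (if j = 0 then (\<lambda>v. L2_inner \<Omega> (f (t 0)) v - ell_op \<Omega> L (U 0) v)
      else L2_inner \<Omega> (delta t U j))"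

definition delta2U ::
    "(real^'n) set \<Rightarrow> 'n coeffs \<Rightarrow> (nat \<Rightarrow> real) \<Rightarrow> (real \<Rightarrow> real^'n \<Rightarrow> real) \<Rightarrow>
     (nat \<Rightarrow> real^'n \<Rightarrow> real) \<Rightarrow> nat \<Rightarrow> 'n functional" where
  "delta2U \<Omega> L t f U j =
     (\<lambda>v. (deltaU \<Omega> L t f U j v - deltaU \<Omega> L t f U (j - 1) v) / step t j)"

definition backward_euler ::
    "(real^'n) set \<Rightarrow> 'n coeffs \<Rightarrow> nat \<Rightarrow> (nat \<Rightarrow> real) \<Rightarrow> (real \<Rightarrow> real^'n \<Rightarrow> real) \<Rightarrow>
     (real^'n \<Rightarrow> real) \<Rightarrow> (nat \<Rightarrow> real^'n \<Rightarrow> real) \<Rightarrow> bool" where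
  "backward_euler \<Omega> L M t f u0 U \<longleftrightarrow>
     (\<forall>j\<le>M. U j \<in> H01 \<Omega>) \<and> U 0 = u0 \<and>
     (\<forall>j\<in>{1..M}. \<forall>v\<in>H01 \<Omega>.
        L2_inner \<Omega> (delta t U j) v + ell_op \<Omega> L (U j) v = L2_inner \<Omega> (f (t j)) v)"

text \<open>
  Continuous functions of time that are piecewise polynomial on the mesh, with values in the span
  of the approximations \<open>U 0, \<dots>, U M\<close>.
\<close>

definition piecewise_poly ::
    "nat \<Rightarrow> (nat \<Rightarrow> real) \<Rightarrow> (nat \<Rightarrow> real^'n \<Rightarrow> real) \<Rightarrow> (real \<Rightarrow> real^'n \<Rightarrow> real) set" where
  "piecewise_poly M t U = {P. \<exists>c :: nat \<Rightarrow> real \<Rightarrow> real.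
     (\<forall>i\<le>M. continuous_on {0..t M} (c i) \<and>
        (\<forall>j\<in>{1..M}. \<exists>q. \<forall>s\<in>{t (j - 1)..t j}. c i s = poly q s)) \<and>
     (\<forall>s\<in>{0..t M}. \<forall>x. P s x = (\<Sum>i\<le>M. c i s * U i x))}"

definition eta_f ::
    "(real^'n) set \<Rightarrow> real \<Rightarrow> (nat \<Rightarrow> real) \<Rightarrow> (real \<Rightarrow> real^'n \<Rightarrow> real) \<Rightarrow> nat \<Rightarrow> ennreal" where
  "eta_f \<Omega> \<kappa>\<^sub>0 t f j = ennreal \<kappa>\<^sub>0 *
     (\<integral>\<^sup>+s\<in>{t (j - 1)<..<t j}. Linf_norm \<Omega> (\<lambda>x. f s x - fhat t f j s x) \<partial>lebesgue)"

definition eta_d2U ::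
    "(real^'n) set \<Rightarrow> 'n coeffs \<Rightarrow> real \<Rightarrow> (nat \<Rightarrow> real) \<Rightarrow> (real \<Rightarrow> real^'n \<Rightarrow> real) \<Rightarrow>
     (nat \<Rightarrow> real^'n \<Rightarrow> real) \<Rightarrow> nat \<Rightarrow> ennreal" where
  "eta_d2U \<Omega> L \<kappa>\<^sub>0 t f U j =
     ennreal (\<kappa>\<^sub>0 * (step t j)\<^sup>2 / 2) * Hm1_Linf_norm \<Omega> (delta2U \<Omega> L t f U j)"

end

theory Submission
  imports Defs
begin

text \<open>
  Let \<open>P\<close> be the continuous, piecewise linear interpolant in time of \<open>U\<^sup>0, \<dots>, U\<^sup>M\<close>.  On the interval
  \<open>I\<^sub>j\<close> its time derivative is \<open>\<delta>\<^sub>t U\<^sup>j\<close>.  Since \<open>L\<close> is linear, \<open>L P\<close> is the linear interpolant of the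
  elements \<open>L U\<^sup>j = f\<^sup>j - \<delta>\<^sub>t U\<^sup>j\<close>; this equation holds for \<open>j = 0\<close> too, because \<open>\<delta>\<^sub>t U\<^sup>0\<close> is defined by
  it.  Interpolating the two terms separately gives, for \<open>s \<in> I\<^sub>j\<close>,
  \<open>(K (u - P)) (s) = (f - fhat) (s) - (t\<^sub>j - s) \<delta>\<^sub>t\<^sup>2 U\<^sup>j\<close> (lemma \<open>residual_eq\<close>).

  As \<open>u - P\<close> vanishes at time 0, the Green's function represents \<open>(u - P) (x, T) = u(x, T) - U\<^sup>M(x)\<close>
  as the integral over \<open>s\<close> of the pairing of this residual with \<open>G (T - s)\<close>.  Hoelder's inequality
  (lemmas \<open>Holder_L1_Linf\<close> and \<open>Hm1_Linf_norm_bound\<close>) and the bound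
  \<open>\<kappa>\<^sub>0 exp (- \<gamma> (T - s)) \<le> \<kappa>\<^sub>0 exp (- \<gamma> (T - t\<^sub>j))\<close> for the \<open>L\<^sub>1\<close> norm of \<open>G (T - s)\<close> estimate the integrand
  on \<open>I\<^sub>j\<close>, and the integral of \<open>t\<^sub>j - s\<close> over \<open>I\<^sub>j\<close> is \<open>\<tau>\<^sub>j\<^sup>2 / 2\<close>.

  Three points take work.  The operator is written with a chosen weak gradient, so that its
  linearity (lemma \<open>ell_op_lincomb\<close>) rests on the almost everywhere uniqueness of weak gradients, that
  is, on the fundamental lemma of the calculus of variations and on the existence of sufficiently
  many test functions.  Secondly, \<open>\<kappa>\<^sub>0\<close> must be positive, for otherwise an infinite norm of \<open>\<delta>\<^sub>t\<^sup>2 U\<^sup>j\<close>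
  would be multiplied by zero on the right-hand side; a Green's function with vanishing \<open>L\<^sub>1\<close> norms
  could not converge to a Dirac distribution (lemma \<open>green_constant_pos\<close>).  Finally, the \<open>L\<^sub>\<infinity>\<close> norm
  of \<open>f - fhat\<close> is possibly not measurable in time, so that its integral is only a lower
  integral; it is split off the measurable modulus of the pairing
  (lemma \<open>nn_integral_le_of_sum_bound\<close>).
\<close>

section \<open>Smooth bump functions\<close>

lemma partial_eq: "(\<phi> has_derivative D) (at x) \<Longrightarrow> partial i \<phi> x = D (axis i 1)"
  unfolding partial_def using frechet_derivative_at by metis

lemma differentiable_times_Suc_D: "differentiable_times (Suc k) \<phi> \<Longrightarrow> differentiable_times k \<phi>"
  by (induction k arbitrary: \<phi>) (auto intro: differentiable_imp_continuous_on)

lemma differentiable_times_const: "differentiable_times k (\<lambda>x :: real^'n. c)"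
proof (induction k arbitrary: c)
  case (Suc k)
  have "partial i (\<lambda>x :: real^'n. c) = (\<lambda>x. 0)" for i
    by (auto intro!: ext simp: partial_eq[OF has_derivative_const])
  then show ?case using Suc by simp
qed simp

lemma partial_add:
  assumes "\<phi> differentiable_on UNIV" "\<psi> differentiable_on UNIV"
  shows "partial i (\<lambda>x. \<phi> x + \<psi> x) = (\<lambda>x. partial i \<phi> x + partial i \<psi> x)"
proof
  fix x
  have "(\<phi> has_derivative frechet_derivative \<phi> (at x)) (at x)"
    "(\<psi> has_derivative frechet_derivative \<psi> (at x)) (at x)"
    using assms by (auto simp: differentiable_on_def frechet_derivative_works)
  from has_derivative_add[OF this]
  show "partial i (\<lambda>x. \<phi> x + \<psi> x) x = partial i \<phi> x + partial i \<psi> x"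
    by (simp add: partial_eq) (simp add: partial_def)
qed

lemma partial_mult:
  assumes "\<phi> differentiable_on UNIV" "\<psi> differentiable_on UNIV"
  shows "partial i (\<lambda>x. \<phi> x * \<psi> x) = (\<lambda>x. \<phi> x * partial i \<psi> x + partial i \<phi> x * \<psi> x)"
proof
  fix x
  have "(\<phi> has_derivative frechet_derivative \<phi> (at x)) (at x)"
    "(\<psi> has_derivative frechet_derivative \<psi> (at x)) (at x)"
    using assms by (auto simp: differentiable_on_def frechet_derivative_works)
  from has_derivative_mult[OF this]
  show "partial i (\<lambda>x. \<phi> x * \<psi> x) x = \<phi> x * partial i \<psi> x + partial i \<phi> x * \<psi> x"
    by (simp add: partial_eq) (simp add: partial_def)
qed

lemma differentiable_times_add:
  "differentiable_times k \<phi> \<Longrightarrow> differentiable_times k \<psi> \<Longrightarrow>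
   differentiable_times k (\<lambda>x. \<phi> x + \<psi> x)"
  by (induction k arbitrary: \<phi> \<psi>)
     (auto intro!: continuous_intros differentiable_on_add simp: partial_add)

lemma differentiable_times_mult:
  "differentiable_times k \<phi> \<Longrightarrow> differentiable_times k \<psi> \<Longrightarrow>
   differentiable_times k (\<lambda>x. \<phi> x * \<psi> x)"
proof (induction k arbitrary: \<phi> \<psi>)
  case (Suc k)
  then have "differentiable_times k \<phi>" "differentiable_times k \<psi>"
    using differentiable_times_Suc_D by blast+
  with Suc show ?case
    by (auto intro!: differentiable_on_mult differentiable_times_add simp: partial_mult)
qed (auto intro!: continuous_intros)

lemma differentiable_times_prod:
  "(\<And>m. m \<in> A \<Longrightarrow> differentiable_times k (\<phi> m)) \<Longrightarrow> differentiable_times k (\<lambda>x. \<Prod>m\<in>A. \<phi> m x)"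
  by (induction A rule: infinite_finite_induct)
     (auto intro: differentiable_times_const differentiable_times_mult)

lemma differentiable_times_power:
  "differentiable_times k \<phi> \<Longrightarrow> differentiable_times k (\<lambda>x. \<phi> x ^ m)"
  by (induction m) (auto intro: differentiable_times_const differentiable_times_mult)

text \<open>
  The derivative of \<open>p(1/y) exp(-1/y)\<close> has the same form with another polynomial.  Admitting all
  polynomials \<open>p\<close> therefore makes smoothness at \<open>y = 0\<close> a plain induction on the order of
  differentiation.
\<close>

definition flat_exp :: "real poly \<Rightarrow> real \<Rightarrow> real" where
  "flat_exp p y = (if y > 0 then poly p (1 / y) * exp (- (1 / y)) else 0)"

lemma poly_times_exp_minus_tendsto_0: "((\<lambda>y. poly p y * exp (- y)) \<longlongrightarrow> (0::real)) at_top"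
proof -
  have "((\<lambda>y. \<Sum>i\<le>degree p. coeff p i * (y ^ i / exp y)) \<longlongrightarrow> (\<Sum>i\<le>degree p. coeff p i * 0)) at_top"
    by (intro tendsto_sum tendsto_mult tendsto_const tendsto_power_div_exp_0)
  moreover have "(\<Sum>i\<le>degree p. coeff p i * (y ^ i / exp y)) = poly p y * exp (- y)" for y
    by (simp add: poly_altdef sum_distrib_right exp_minus divide_inverse mult.assoc)
  ultimately show ?thesis by simp
qed

lemma flat_exp_derivative:
  "(flat_exp p has_real_derivative flat_exp ([:0, 0, 1:] * (p - pderiv p)) y) (at y)"
proof -
  let ?q = "[:0, 0, 1:] * (p - pderiv p)"
  consider "y > 0" | "y < 0" | "y = 0" by linarith
  then show ?thesis
  proof cases
    case 1
    have "((\<lambda>y. poly p (1 / y) * exp (- (1 / y))) has_real_derivative flat_exp ?q y) (at y)"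
      using 1 by (auto intro!: derivative_eq_intros DERIV_chain'[OF _ poly_DERIV]
          simp: flat_exp_def field_simps power2_eq_square)
    then show ?thesis
      by (rule has_field_derivative_transform_within_open[of _ _ _ "{0<..}"])
         (use 1 in \<open>auto simp: flat_exp_def\<close>)
  next
    case 2
    have "((\<lambda>y. 0) has_real_derivative flat_exp ?q y) (at y)"
      using 2 by (simp add: flat_exp_def)
    then show ?thesis
      by (rule has_field_derivative_transform_within_open[of _ _ _ "{..<0}"])
         (use 2 in \<open>auto simp: flat_exp_def\<close>)
  next
    case 3
    have "((\<lambda>h. flat_exp p h / h) \<longlongrightarrow> 0) (at 0)"
    proof (rule filterlim_split_at)
      show "((\<lambda>h. flat_exp p h / h) \<longlongrightarrow> 0) (at_left 0)"
        by (rule tendsto_eventually)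
           (auto simp: flat_exp_def eventually_at_filter intro: always_eventually)
      have "((\<lambda>h. poly ([:0, 1:] * p) (inverse h) * exp (- inverse h)) \<longlongrightarrow> 0) (at_right (0::real))"
        by (rule filterlim_compose[OF poly_times_exp_minus_tendsto_0 filterlim_inverse_at_top_right])
      then show "((\<lambda>h. flat_exp p h / h) \<longlongrightarrow> 0) (at_right 0)"
        by (rule Lim_transform_eventually)
           (auto simp: flat_exp_def eventually_at_filter field_simps)
    qed
    then show ?thesis
      using 3 by (simp add: DERIV_def flat_exp_def)
  qed
qed

lemma differentiable_times_flat_exp:
  assumes "\<And>k. differentiable_times k \<rho>"
  shows "differentiable_times k (\<lambda>x. flat_exp p (\<rho> x))"
proof (induction k arbitrary: p)
  case 0
  have "isCont (flat_exp p) y" for y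
    using flat_exp_derivative DERIV_isCont by blast
  then have "continuous_on UNIV (flat_exp p)"
    by (simp add: continuous_at_imp_continuous_on)
  with assms[of 0] show ?case
    by (auto intro: continuous_on_compose2)
next
  case (Suc k)
  let ?q = "[:0, 0, 1:] * (p - pderiv p)"
  have \<rho>: "(\<rho> has_derivative frechet_derivative \<rho> (at x)) (at x)" for x
    using assms[of 1] by (auto simp: differentiable_on_def frechet_derivative_works)
  have D: "((\<lambda>x. flat_exp p (\<rho> x)) has_derivative
      (\<lambda>v. frechet_derivative \<rho> (at x) v * flat_exp ?q (\<rho> x))) (at x)" for x
    using has_derivative_compose[OF \<rho> flat_exp_derivative[unfolded has_field_derivative_def]]
    by (simp add: mult.commute)
  have "partial i (\<lambda>x. flat_exp p (\<rho> x)) = (\<lambda>x. partial i \<rho> x * flat_exp ?q (\<rho> x))" for i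
    using partial_eq[OF D] by (auto simp: partial_def)
  moreover have "differentiable_times k (partial i \<rho>)" for i
    using assms[of "Suc k"] by simp
  moreover have "(\<lambda>x. flat_exp p (\<rho> x)) differentiable_on UNIV"
    using D by (auto simp: differentiable_on_def differentiable_def)
  ultimately show ?case
    using Suc[of ?q] by (auto intro!: differentiable_times_mult)
qed

lemma differentiable_times_sq_dist: "differentiable_times k (\<lambda>x. r - (x - c) \<bullet> (x - c))"
proof -
  have nth: "differentiable_times k (\<lambda>x. a * (x - c) $ i)" for k a i
  proof (cases k)
    case 0 then show ?thesis by (auto intro!: continuous_intros)
  next
    case (Suc m)
    have D: "((\<lambda>x. a * (x - c) $ i) has_derivative (\<lambda>v. a * v $ i)) (at x)" for x
      by (auto intro!: derivative_eq_intros bounded_linear.has_derivative[OF bounded_linear_vec_nth])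
    then have "partial j (\<lambda>x. a * (x - c) $ i) = (\<lambda>x. a * axis j 1 $ i)" for j
      using partial_eq[OF D] by auto
    then show ?thesis
      using D differentiable_times_const Suc
      by (auto simp: differentiable_on_def differentiable_def)
  qed
  show ?thesis
  proof (cases k)
    case 0 then show ?thesis by (auto intro!: continuous_intros)
  next
    case (Suc m)
    have D: "((\<lambda>x. r - (x - c) \<bullet> (x - c)) has_derivative (\<lambda>v. - (2 * ((x - c) \<bullet> v)))) (at x)" for x
      by (auto intro!: derivative_eq_intros simp: inner_commute)
    then have "partial j (\<lambda>x. r - (x - c) \<bullet> (x - c)) = (\<lambda>x. -2 * (x - c) $ j)" for j
      using partial_eq[OF D] by (auto simp: inner_axis)
    then show ?thesis
      using D nth[of m "-2"] Suc
      by (auto simp: differentiable_on_def differentiable_def simp del: vector_minus_component)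
  qed
qed

text \<open>
  As \<open>flat_exp 1 y\<close> is \<open>exp(-1/y)\<close> for \<open>y > 0\<close>, the values lie below 1; this lets powers of
  \<open>1 - bump c r x\<close> tend to 0 inside the ball.
\<close>

definition bump :: "real^'n \<Rightarrow> real \<Rightarrow> real^'n \<Rightarrow> real" where
  "bump c r x = flat_exp 1 (r\<^sup>2 - (x - c) \<bullet> (x - c))"

lemma differentiable_times_bump: "differentiable_times k (bump c r)"
  unfolding bump_def[abs_def]
  by (intro differentiable_times_flat_exp differentiable_times_sq_dist)

lemma bump_range: "0 \<le> bump c r x" "bump c r x < 1"
  by (auto simp: bump_def flat_exp_def)

lemma bump_pos_iff: "r > 0 \<Longrightarrow> bump c r x > 0 \<longleftrightarrow> x \<in> ball c r"
proof -
  assume "r > 0"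
  have "(x - c) \<bullet> (x - c) < r\<^sup>2 \<longleftrightarrow> dist c x < r"
    using \<open>r > 0\<close> power2_less_imp_less[of "norm (x - c)" r] power_strict_mono[of "norm (x - c)" r 2]
    by (auto simp: dist_norm norm_minus_commute[of c] power2_norm_eq_inner)
  then show ?thesis
    by (auto simp: bump_def flat_exp_def)
qed

lemma bump_zero: "r > 0 \<Longrightarrow> x \<notin> ball c r \<Longrightarrow> bump c r x = 0"
  using bump_pos_iff[of r c x] bump_range[of c r x] by linarith

text \<open>
  Countably many balls whose closures lie in the open set cover it.  If \<open>\<beta>\<^sub>m\<close> is a bump on the \<open>m\<close>-th
  ball, then \<open>1 - (\<Prod>m<k. (1 - \<beta>\<^sub>m)\<^sup>k)\<close> is supported in finitely many of the closed balls, and at a point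
  of the \<open>m\<close>-th ball it tends to 1, because \<open>(1 - \<beta>\<^sub>m)\<^sup>k\<close> does to 0.
\<close>

lemma open_indicator_limit_of_test_functions:
  fixes W :: "(real^'n) set"
  assumes "open W"
  obtains \<phi> where "\<And>k. \<phi> k \<in> test_functions W" "\<And>k x. 0 \<le> \<phi> k x \<and> \<phi> k x \<le> 1"
    "\<And>x. (\<lambda>k. \<phi> k x) \<longlonglongrightarrow> indicator W x"
proof -
  define F where "F = {ball c r |c r. r > 0 \<and> cball c r \<subseteq> W}"
  obtain F' where F': "F' \<subseteq> F" "countable F'" "\<Union>F' = \<Union>F"
    using Lindelof[of F] unfolding F_def by blast
  have "\<Union>F = W"
    unfolding F_def using assms open_contains_cball[of W] centre_in_ball ball_subset_cball by blast
  \<comment> \<open>The empty set is added so that \<open>from_nat_into\<close> enumerates the family also when it has no ball.\<close>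
  define G where "G = insert {} F'"
  have "countable G" "G \<noteq> {}" "\<Union>G = W" using F' \<open>\<Union>F = W\<close> by (auto simp: G_def)
  have "\<exists>\<beta> K. (\<forall>k. differentiable_times k \<beta>) \<and> compact K \<and> K \<subseteq> W \<and>
      (\<forall>x. 0 \<le> \<beta> x \<and> \<beta> x < 1 \<and> (x \<in> B \<longrightarrow> \<beta> x > 0) \<and> (x \<notin> K \<longrightarrow> \<beta> x = 0))" if "B \<in> G" for B
  proof (cases "B = {}")
    case True
    then show ?thesis
      by (intro exI[of _ "\<lambda>x. 0"] exI[of _ "{}"]) (auto intro: differentiable_times_const)
  next
    case False
    then have "B \<in> F" using that F'(1) by (auto simp: G_def)
    then obtain c r where "B = ball c r" "r > 0" "cball c r \<subseteq> W"
      unfolding F_def by auto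
    then show ?thesis
      by (intro exI[of _ "bump c r"] exI[of _ "cball c r"])
         (use bump_zero ball_subset_cball in \<open>auto simp: bump_pos_iff bump_range differentiable_times_bump bump_zero\<close>)
  qed
  then obtain \<beta> K where \<beta>K: "\<And>B. B \<in> G \<Longrightarrow> (\<forall>k. differentiable_times k (\<beta> B)) \<and> compact (K B) \<and> K B \<subseteq> W \<and>
      (\<forall>x. 0 \<le> \<beta> B x \<and> \<beta> B x < 1 \<and> (x \<in> B \<longrightarrow> \<beta> B x > 0) \<and> (x \<notin> K B \<longrightarrow> \<beta> B x = 0))"
    by metis
  define b where "b m = from_nat_into G m" for m
  have b: "b m \<in> G" for m by (simp add: b_def \<open>G \<noteq> {}\<close> from_nat_into)
  define \<phi> where "\<phi> k x = 1 + (-1) * (\<Prod>m<k. (1 + (-1) * \<beta> (b m) x) ^ k)" for k x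
  have fac: "0 \<le> (1 + (-1) * \<beta> (b m) x) ^ k" "(1 + (-1) * \<beta> (b m) x) ^ k \<le> 1" for m k x
    using \<beta>K[OF b[of m]] by (auto intro!: power_le_one simp: less_imp_le)
  have pr: "0 \<le> (\<Prod>m<k. (1 + (-1) * \<beta> (b m) x) ^ k)" "(\<Prod>m<k. (1 + (-1) * \<beta> (b m) x) ^ k) \<le> 1" for k x
    using fac by (auto intro!: prod_nonneg prod_le_1)
  show thesis
  proof
    fix k
    have "differentiable_times l (\<phi> k)" for l
      unfolding \<phi>_def[abs_def] using \<beta>K[OF b]
      by (intro differentiable_times_add differentiable_times_mult differentiable_times_const
          differentiable_times_prod differentiable_times_power) auto
    moreover have "\<phi> k x = 0" if "x \<notin> (\<Union>m<k. K (b m))" for x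
    proof -
      have "\<beta> (b m) x = 0" if "m < k" for m
        using \<beta>K[OF b[of m]] \<open>x \<notin> _\<close> that by blast
      then show ?thesis by (simp add: \<phi>_def)
    qed
    moreover have "compact (\<Union>m<k. K (b m))" "(\<Union>m<k. K (b m)) \<subseteq> W"
      using \<beta>K[OF b] by (auto intro!: compact_UN)
    ultimately show "\<phi> k \<in> test_functions W"
      unfolding test_functions_def by blast
  next
    fix k x show "0 \<le> \<phi> k x \<and> \<phi> k x \<le> 1"
      using pr[of x k] by (auto simp: \<phi>_def)
  next
    fix x
    show "(\<lambda>k. \<phi> k x) \<longlonglongrightarrow> indicator W x"
    proof (cases "x \<in> W")
      case False
      have "\<beta> (b m) x = 0" for m
        using \<beta>K[OF b[of m]] False by blast
      then show ?thesis using False by (simp add: \<phi>_def)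
    next
      case True
      then obtain B where "B \<in> G" "x \<in> B" using \<open>\<Union>G = W\<close> by auto
      then obtain n where n: "x \<in> b n"
        using from_nat_into_surj[OF \<open>countable G\<close> \<open>B \<in> G\<close>] by (auto simp: b_def)
      define a where "a = 1 + (-1) * \<beta> (b n) x"
      have a: "0 \<le> a" "a < 1" using \<beta>K[OF b[of n]] n by (auto simp: a_def less_imp_le)
      have "(\<Prod>m<k. (1 + (-1) * \<beta> (b m) x) ^ k) \<le> a ^ k" if "k > n" for k
      proof -
        have "(\<Prod>m<k. (1 + (-1) * \<beta> (b m) x) ^ k)
            = a ^ k * (\<Prod>m\<in>{..<k} - {n}. (1 + (-1) * \<beta> (b m) x) ^ k)"
          using that unfolding a_def by (subst prod.remove[of _ n]) auto
        also have "\<dots> \<le> a ^ k * 1"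
          using a fac by (intro mult_left_mono prod_le_1) auto
        finally show ?thesis by simp
      qed
      then have "\<forall>\<^sub>F k in sequentially. (\<Prod>m<k. (1 + (-1) * \<beta> (b m) x) ^ k) \<le> a ^ k"
        by (rule eventually_sequentiallyI[of "Suc n"]) simp
      then have "(\<lambda>k. \<Prod>m<k. (1 + (-1) * \<beta> (b m) x) ^ k) \<longlonglongrightarrow> 0"
        using a pr by (intro tendsto_sandwich[OF _ _ tendsto_const LIMSEQ_realpow_zero[of a]])
          (auto intro: always_eventually)
      from tendsto_add[OF tendsto_const tendsto_mult[OF tendsto_const this], of 1 "-1"]
      show ?thesis using True by (simp add: \<phi>_def)
    qed
  qed
qed

section \<open>The fundamental lemma of the calculus of variations\<close>

lemma integrable_mult_of_square_integrable:
  fixes f g :: "'a \<Rightarrow> real"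
  assumes "f \<in> borel_measurable N" "integrable N (\<lambda>x. (f x)\<^sup>2)"
    and "g \<in> borel_measurable N" "integrable N (\<lambda>x. (g x)\<^sup>2)"
  shows "integrable N (\<lambda>x. f x * g x)"
proof (rule Bochner_Integration.integrable_bound)
  show "integrable N (\<lambda>x. (f x)\<^sup>2 + (g x)\<^sup>2)" using assms by simp
  show "(\<lambda>x. f x * g x) \<in> borel_measurable N" using assms by simp
  have "\<bar>f x * g x\<bar> \<le> (f x)\<^sup>2 + (g x)\<^sup>2" for x
  proof -
    have "2 * (\<bar>f x\<bar> * \<bar>g x\<bar>) \<le> (f x)\<^sup>2 + (g x)\<^sup>2"
      using sum_squares_bound[of "\<bar>f x\<bar>" "\<bar>g x\<bar>"] by (simp add: mult.assoc)
    moreover have "0 \<le> \<bar>f x\<bar> * \<bar>g x\<bar>" by simp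
    ultimately show ?thesis unfolding abs_mult by linarith
  qed
  then show "AE x in N. norm (f x * g x) \<le> norm ((f x)\<^sup>2 + (g x)\<^sup>2)" by simp
qed

lemma test_functions_mono: "W \<subseteq> \<Omega> \<Longrightarrow> test_functions W \<subseteq> test_functions \<Omega>"
  unfolding test_functions_def by blast

lemma test_function_zero_outside: "\<phi> \<in> test_functions \<Omega> \<Longrightarrow> x \<notin> \<Omega> \<Longrightarrow> \<phi> x = 0"
  unfolding test_functions_def by blast

lemma test_function_measurable: "\<phi> \<in> test_functions \<Omega> \<Longrightarrow> \<phi> \<in> borel_measurable (lebesgue_on S)"
proof -
  assume "\<phi> \<in> test_functions \<Omega>"
  then have "continuous_on UNIV \<phi>"
    unfolding test_functions_def using differentiable_times.simps(1) by blast
  then have "\<phi> \<in> borel_measurable borel" by (rule borel_measurable_continuous_onI)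
  then show ?thesis
    by (intro measurable_restrict_space1 measurable_completion) simp
qed

text \<open>
  Test functions approximate the indicators of bounded open subsets \<open>W\<close>, so the integral of \<open>h\<close> over
  \<open>W\<close> is zero; hence so is that over \<open>W - (W - K) = K\<close> for closed \<open>K \<subseteq> W\<close>.  If \<open>h > 0\<close> on \<open>K\<close>, then \<open>K\<close> is a null set,
  and by inner regularity the same holds for all of the set where \<open>h > 0\<close>.
\<close>

lemma AE_nonpos_if_orthogonal_to_test_functions:
  fixes \<Omega> :: "(real^'n) set"
  assumes "open \<Omega>" and h [measurable]: "h \<in> borel_measurable (lebesgue_on \<Omega>)"
    and h2: "integrable (lebesgue_on \<Omega>) (\<lambda>x. (h x)\<^sup>2)"
    and orth: "\<And>\<phi>. \<phi> \<in> test_functions \<Omega> \<Longrightarrow> (LINT x|lebesgue_on \<Omega>. h x * \<phi> x) = 0"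
  shows "AE x in lebesgue_on \<Omega>. h x \<le> 0"
proof -
  let ?M = "lebesgue_on \<Omega>"
  have \<Omega>: "\<Omega> \<in> sets lebesgue" using assms(1) by simp
  have ind: "integrable ?M (\<lambda>x. indicator W x * h x)" if "W \<subseteq> \<Omega>" "bounded W" "W \<in> sets lebesgue" for W
  proof (rule integrable_mult_of_square_integrable[OF _ _ h h2])
    have "W \<in> lmeasurable" using that bounded_set_imp_lmeasurable by blast
    then have "emeasure ?M W < \<infinity>"
      using that \<Omega> by (simp add: emeasure_restrict_space fmeasurable_def)
    moreover have W: "W \<in> sets ?M" using that \<Omega> by (simp add: sets_restrict_space_iff)
    ultimately have "integrable ?M (indicator W :: _ \<Rightarrow> real)" by simp
    moreover have "(indicator W x :: real)\<^sup>2 = indicator W x" for x by (simp add: indicator_def)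
    ultimately show "integrable ?M (\<lambda>x. (indicator W x :: real)\<^sup>2)" by simp
    show "(indicator W :: _ \<Rightarrow> real) \<in> borel_measurable ?M" using W by simp
  qed
  have open_zero: "(LINT x|?M. indicator W x * h x) = 0" if W: "W \<subseteq> \<Omega>" "bounded W" "open W" for W
  proof -
    obtain \<phi> where \<phi>: "\<And>k. \<phi> k \<in> test_functions W" "\<And>k x. 0 \<le> \<phi> k x \<and> \<phi> k x \<le> 1"
        "\<And>x. (\<lambda>k. \<phi> k x) \<longlonglongrightarrow> indicator W x"
      using open_indicator_limit_of_test_functions[OF W(3)] by metis
    note [measurable] = test_function_measurable[OF \<phi>(1)]
    have i: "integrable ?M (\<lambda>x. indicator W x * h x)" using ind[of W] W by simp
    have "(\<lambda>k. LINT x|?M. \<phi> k x * h x) \<longlonglongrightarrow> (LINT x|?M. indicator W x * h x)"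
    proof (rule integral_dominated_convergence)
      show "integrable ?M (\<lambda>x. \<bar>indicator W x * h x\<bar>)" using i by simp
      show "(\<lambda>x. indicator W x * h x) \<in> borel_measurable ?M" using i by (rule borel_measurable_integrable)
      show "(\<lambda>x. \<phi> k x * h x) \<in> borel_measurable ?M" for k by measurable
      show "AE x in ?M. (\<lambda>k. \<phi> k x * h x) \<longlonglongrightarrow> indicator W x * h x"
        using \<phi>(3) by (intro AE_I2 tendsto_mult tendsto_const)
      show "AE x in ?M. norm (\<phi> k x * h x) \<le> \<bar>indicator W x * h x\<bar>" for k
      proof (rule AE_I2)
        fix x
        show "norm (\<phi> k x * h x) \<le> \<bar>indicator W x * h x\<bar>"
          using \<phi>(2)[of k x] test_function_zero_outside[OF \<phi>(1), of x k]
          by (cases "x \<in> W") (auto simp: abs_mult intro: mult_left_le_one_le)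
      qed
    qed
    moreover have "(LINT x|?M. \<phi> k x * h x) = 0" for k
      using orth[of "\<phi> k"] \<phi>(1)[of k] test_functions_mono[OF W(1)] by (auto simp: mult.commute)
    ultimately show ?thesis by (simp add: LIMSEQ_const_iff)
  qed
  \<comment> \<open>A square integrable function need not be integrable; restriction to a ball makes \<open>h\<close> so.\<close>
  have "AE x in ?M. \<not> (h x > 0 \<and> x \<in> ball 0 (real R))" for R
  proof -
    define W where "W = \<Omega> \<inter> ball 0 (real R)"
    have W: "W \<subseteq> \<Omega>" "bounded W" "open W" using assms(1) by (auto simp: W_def)
    define A where "A = {x \<in> W. h x > 0}"
    have "A = {x \<in> space ?M. h x > 0} \<inter> W" by (auto simp: A_def W_def)
    moreover have "W \<in> sets ?M" using W \<Omega> by (simp add: sets_restrict_space_iff)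
    moreover have "{x \<in> space ?M. h x > 0} \<in> sets ?M" by measurable
    ultimately have "A \<in> sets ?M" by (simp only: sets.Int)
    then have A: "A \<in> sets lebesgue" using \<Omega> by (simp add: sets_restrict_space_iff)
    have "emeasure lebesgue A \<le> ennreal e" if "e > 0" for e
    proof -
      obtain K where K: "closed K" "K \<subseteq> A" "A - K \<in> lmeasurable" "emeasure lebesgue (A - K) < ennreal e"
        using sets_lebesgue_inner_closed[OF A \<open>e > 0\<close>] by metis
      have "K \<subseteq> W" using K by (auto simp: A_def)
      have KM: "K \<in> sets ?M" using K \<open>K \<subseteq> W\<close> W(1) \<Omega> by (auto simp: sets_restrict_space_iff)
      have WK: "W - K \<subseteq> \<Omega>" "bounded (W - K)" "open (W - K)" using W K by (auto intro: bounded_subset)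
      have eq: "indicator K x * h x = indicator W x * h x - indicator (W - K) x * h x" for x
        using \<open>K \<subseteq> W\<close> by (auto simp: indicator_def)
      have iK: "integrable ?M (\<lambda>x. indicator K x * h x)"
        unfolding eq using ind[of W] ind[of "W - K"] W WK by simp
      have "(LINT x|?M. indicator K x * h x) = 0"
        unfolding eq using ind[of W] ind[of "W - K"] W WK open_zero[OF W] open_zero[OF WK]
        by simp
      moreover have "AE x in ?M. 0 \<le> indicator K x * h x"
        using K(2) by (intro AE_I2) (auto simp: indicator_def A_def)
      ultimately have "AE x in ?M. indicator K x * h x = 0"
        using integral_nonneg_eq_0_iff_AE[OF iK] by simp
      moreover have "indicator K x * h x = 0 \<longleftrightarrow> x \<notin> K" for x
        using K(2) by (auto simp: indicator_def A_def)
      ultimately have "AE x in ?M. x \<notin> K" by simp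
      then have "emeasure ?M K = 0"
        using KM by (simp add: AE_iff_measurable[OF KM] sets.sets_into_space[OF KM] AE_iff_null_sets null_setsD1)
      then have "emeasure lebesgue K = 0"
        using \<open>K \<subseteq> W\<close> W(1) \<Omega> by (simp add: emeasure_restrict_space)
      moreover have "emeasure lebesgue A \<le> emeasure lebesgue K + emeasure lebesgue (A - K)"
        using emeasure_subadditive[of K lebesgue "A - K"] K A
        by (simp add: Un_absorb1 sets.Diff)
      ultimately show ?thesis using K(4) by simp
    qed
    then have "emeasure lebesgue A = 0"
      using ennreal_le_epsilon[of 0 "emeasure lebesgue A"] by simp
    then have "emeasure ?M A = 0"
      using W(1) \<Omega> A by (subst emeasure_restrict_space) (auto simp: A_def)
    then have "A \<in> null_sets ?M" using \<open>A \<in> sets ?M\<close> by auto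
    then show ?thesis
      by (rule AE_I') (auto simp: A_def W_def)
  qed
  then have "AE x in ?M. \<forall>R::nat. \<not> (h x > 0 \<and> x \<in> ball 0 (real R))"
    unfolding AE_all_countable by (rule allI)
  then show ?thesis
  proof (rule eventually_mono)
    fix x assume *: "\<forall>R::nat. \<not> (h x > 0 \<and> x \<in> ball 0 (real R))"
    obtain R :: nat where "norm x < real R" using reals_Archimedean2 by blast
    with * show "h x \<le> 0" by (metis dist_0_norm mem_ball not_le)
  qed
qed

lemma fundamental_lemma_of_variations:
  fixes \<Omega> :: "(real^'n) set"
  assumes "open \<Omega>" and h: "h \<in> borel_measurable (lebesgue_on \<Omega>)"
    and h2: "integrable (lebesgue_on \<Omega>) (\<lambda>x. (h x)\<^sup>2)"
    and orth: "\<And>\<phi>. \<phi> \<in> test_functions \<Omega> \<Longrightarrow> (LINT x|lebesgue_on \<Omega>. h x * \<phi> x) = 0"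
  shows "AE x in lebesgue_on \<Omega>. h x = 0"
proof -
  have "AE x in lebesgue_on \<Omega>. - h x \<le> 0"
    using AE_nonpos_if_orthogonal_to_test_functions[of \<Omega> "\<lambda>x. - h x"] assms by simp
  moreover have "AE x in lebesgue_on \<Omega>. h x \<le> 0"
    using AE_nonpos_if_orthogonal_to_test_functions assms by blast
  ultimately show ?thesis by eventually_elim simp
qed

section \<open>The space L2 and functionals on H01\<close>

lemma L2_lincomb:
  assumes "v \<in> L2 \<Omega>" "w \<in> L2 \<Omega>"
  shows "(\<lambda>x. a * v x + b * w x) \<in> L2 \<Omega>"
proof -
  have "integrable (lebesgue_on \<Omega>) (\<lambda>x. a\<^sup>2 * (v x)\<^sup>2 + 2 * a * b * (v x * w x) + b\<^sup>2 * (w x)\<^sup>2)"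
    using assms integrable_mult_of_square_integrable[of v _ w] by (auto simp: L2_def)
  moreover have "a\<^sup>2 * (v x)\<^sup>2 + 2 * a * b * (v x * w x) + b\<^sup>2 * (w x)\<^sup>2 = (a * v x + b * w x)\<^sup>2" for x
    by (simp add: power2_eq_square algebra_simps)
  moreover have "(\<lambda>x. a * v x + b * w x) \<in> borel_measurable (lebesgue_on \<Omega>)"
    using assms by (intro borel_measurable_add borel_measurable_times borel_measurable_const) (auto simp: L2_def)
  ultimately show ?thesis by (simp add: L2_def)
qed

lemma L2_integrable_mult:
  "v \<in> L2 \<Omega> \<Longrightarrow> w \<in> L2 \<Omega> \<Longrightarrow> integrable (lebesgue_on \<Omega>) (\<lambda>x. v x * w x)"
  by (auto simp: L2_def intro: integrable_mult_of_square_integrable)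

lemma L2_inner_lincomb:
  assumes "u \<in> L2 \<Omega>" "v \<in> L2 \<Omega>" "w \<in> L2 \<Omega>"
  shows "L2_inner \<Omega> (\<lambda>x. a * u x + b * v x) w = a * L2_inner \<Omega> u w + b * L2_inner \<Omega> v w"
  using L2_integrable_mult[of u \<Omega> w] L2_integrable_mult[of v \<Omega> w] assms
  by (simp add: L2_inner_def distrib_right mult.assoc)

lemma L2_diff:
  assumes "u \<in> L2 \<Omega>" "v \<in> L2 \<Omega>"
  shows "(\<lambda>x. u x - v x) \<in> L2 \<Omega>"
    and "w \<in> L2 \<Omega> \<Longrightarrow> L2_inner \<Omega> (\<lambda>x. u x - v x) w = L2_inner \<Omega> u w - L2_inner \<Omega> v w"
  using L2_lincomb[OF assms, of 1 "- 1"] L2_inner_lincomb[OF assms, of w 1 "- 1"] by auto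

lemma L2_inner_commute: "L2_inner \<Omega> v w = L2_inner \<Omega> w v"
  by (simp add: L2_inner_def mult.commute)

text \<open>
  The square norm of \<open>v - s w\<close> is a nonnegative quadratic polynomial in \<open>s\<close>.
\<close>

lemma L2_Cauchy_Schwarz:
  assumes "v \<in> L2 \<Omega>" "w \<in> L2 \<Omega>"
  shows "\<bar>L2_inner \<Omega> v w\<bar> \<le> sqrt (L2_inner \<Omega> v v) * sqrt (L2_inner \<Omega> w w)"
proof -
  let ?B = "L2_inner \<Omega> v w" and ?V = "L2_inner \<Omega> v v" and ?W = "L2_inner \<Omega> w w"
  have nonneg: "0 \<le> L2_inner \<Omega> z z" for z
    by (simp add: L2_inner_def)
  have quad: "0 \<le> ?V - 2 * s * ?B + s\<^sup>2 * ?W" for s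
  proof -
    let ?z = "\<lambda>x. 1 * v x + (- s) * w x"
    have z: "?z \<in> L2 \<Omega>" using assms by (rule L2_lincomb)
    have "L2_inner \<Omega> ?z ?z = 1 * L2_inner \<Omega> v ?z + (- s) * L2_inner \<Omega> w ?z"
      by (rule L2_inner_lincomb[OF assms z])
    also have "L2_inner \<Omega> v ?z = 1 * L2_inner \<Omega> v v + (- s) * L2_inner \<Omega> w v"
      by (subst L2_inner_commute) (rule L2_inner_lincomb[OF assms assms(1)])
    also have "L2_inner \<Omega> w ?z = 1 * L2_inner \<Omega> v w + (- s) * L2_inner \<Omega> w w"
      by (subst L2_inner_commute) (rule L2_inner_lincomb[OF assms assms(2)])
    finally show ?thesis
      using nonneg[of ?z] L2_inner_commute[of \<Omega> w v] by (simp add: power2_eq_square algebra_simps)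
  qed
  have "?B\<^sup>2 \<le> ?V * ?W"
  proof (cases "?W = 0")
    case True
    have "?B = 0"
    proof (rule ccontr)
      assume "?B \<noteq> 0"
      \<comment> \<open>Without its quadratic term the polynomial takes the value \<open>-1\<close> at this point.\<close>
      then show False using quad[of "(?V + 1) / (2 * ?B)"] True by simp
    qed
    then show ?thesis using True by simp
  next
    case False
    then have "?W > 0" using nonneg[of w] by simp
    with quad[of "?B / ?W"] show ?thesis
      by (simp add: field_simps power2_eq_square)
  qed
  then have "sqrt (?B\<^sup>2) \<le> sqrt (?V * ?W)" by (rule real_sqrt_le_mono)
  then show ?thesis by (simp add: real_sqrt_mult)
qed

lemma H01_subset_H1: "v \<in> H01 \<Omega> \<Longrightarrow> v \<in> H1 \<Omega>"
  by (simp add: H01_def)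

lemma H1_subset_L2: "v \<in> H1 \<Omega> \<Longrightarrow> v \<in> L2 \<Omega>"
  by (simp add: H1_def)

lemma H01_subset_L2: "v \<in> H01 \<Omega> \<Longrightarrow> v \<in> L2 \<Omega>"
  by (simp add: H01_def H1_def)

lemma L2_inner_in_Hm1:
  assumes g: "g \<in> L2 \<Omega>"
  shows "L2_inner \<Omega> g \<in> Hm1 \<Omega>"
proof -
  have "L2_inner \<Omega> g (\<lambda>x. a * v x + b * w x) = a * L2_inner \<Omega> g v + b * L2_inner \<Omega> g w"
    if "v \<in> H01 \<Omega>" "w \<in> H01 \<Omega>" for v w a b
    using L2_inner_lincomb[OF that[THEN H01_subset_L2] g] by (simp add: L2_inner_commute)
  moreover have "\<bar>L2_inner \<Omega> g v\<bar> \<le> sqrt (L2_inner \<Omega> g g) * H1_norm \<Omega> v" if "v \<in> H01 \<Omega>" for v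
  proof -
    have "sqrt (L2_inner \<Omega> v v) \<le> H1_norm \<Omega> v"
      by (simp add: H1_norm_def L2_inner_def power2_eq_square[symmetric])
    moreover have "0 \<le> sqrt (L2_inner \<Omega> g g)" by (simp add: L2_inner_def)
    ultimately show ?thesis
      using L2_Cauchy_Schwarz[OF g H01_subset_L2[OF that]] mult_left_mono by (meson order_trans)
  qed
  ultimately show ?thesis unfolding Hm1_def by blast
qed

lemma Hm1_diff:
  assumes "k \<in> Hm1 \<Omega>" "l \<in> Hm1 \<Omega>"
  shows "(\<lambda>v. k v - l v) \<in> Hm1 \<Omega>"
proof -
  obtain C D where CD: "\<And>v. v \<in> H01 \<Omega> \<Longrightarrow> \<bar>k v\<bar> \<le> C * H1_norm \<Omega> v"
      "\<And>v. v \<in> H01 \<Omega> \<Longrightarrow> \<bar>l v\<bar> \<le> D * H1_norm \<Omega> v"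
    using assms unfolding Hm1_def by blast
  have "\<bar>k v - l v\<bar> \<le> (C + D) * H1_norm \<Omega> v" if "v \<in> H01 \<Omega>" for v
    using CD[OF that] by (simp add: distrib_right)
  moreover have "k (\<lambda>x. a * v x + b * w x) - l (\<lambda>x. a * v x + b * w x) = a * (k v - l v) + b * (k w - l w)"
    if "v \<in> H01 \<Omega>" "w \<in> H01 \<Omega>" for v w a b
  proof -
    have "k (\<lambda>x. a * v x + b * w x) = a * k v + b * k w" "l (\<lambda>x. a * v x + b * w x) = a * l v + b * l w"
      using assms that unfolding Hm1_def by blast+
    then show ?thesis by (simp add: algebra_simps)
  qed
  ultimately show ?thesis unfolding Hm1_def by blast
qed

section \<open>Weak gradients\<close>

lemma test_function_in_L2:
  assumes \<phi>: "\<phi> \<in> test_functions \<Omega>" and "open \<Omega>"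
  shows "\<phi> \<in> L2 \<Omega>"
proof -
  obtain K where K: "K \<subseteq> \<Omega>" "compact K" "\<And>x. x \<notin> K \<Longrightarrow> \<phi> x = 0"
    using \<phi> unfolding test_functions_def by blast
  have cont: "continuous_on UNIV \<phi>"
    using \<phi> differentiable_times.simps(1) unfolding test_functions_def by blast
  then have "bounded (\<phi> ` K)"
    using K(2) by (meson compact_continuous_image compact_imp_bounded continuous_on_subset subset_UNIV)
  then obtain B where B: "\<And>x. x \<in> K \<Longrightarrow> \<bar>\<phi> x\<bar> \<le> B"
    unfolding bounded_iff by auto
  have m: "\<phi> \<in> borel_measurable (lebesgue_on \<Omega>)" using \<phi> by (rule test_function_measurable)
  have Ks: "K \<in> sets (lebesgue_on \<Omega>)"
    using K assms(2) by (simp add: sets_restrict_space_iff borel_compact)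
  have "K \<in> lmeasurable" using K(2) by (rule lmeasurable_compact)
  moreover have "emeasure (lebesgue_on \<Omega>) K = emeasure lebesgue K"
    using K(1) assms(2) by (intro emeasure_restrict_space) auto
  ultimately have "emeasure (lebesgue_on \<Omega>) K < \<infinity>"
    by (simp only: fmeasurable_def mem_Collect_eq)
  with Ks have "integrable (lebesgue_on \<Omega>) (\<lambda>x. B\<^sup>2 * indicator K x)" by simp
  then have "integrable (lebesgue_on \<Omega>) (\<lambda>x. (\<phi> x)\<^sup>2)"
  proof (rule Bochner_Integration.integrable_bound)
    show "(\<lambda>x. (\<phi> x)\<^sup>2) \<in> borel_measurable (lebesgue_on \<Omega>)" using m by simp
    have "(\<phi> x)\<^sup>2 \<le> B\<^sup>2 * indicator K x" for x
      using power_mono[OF B[of x], of 2] K(3)[of x] by (cases "x \<in> K") auto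
    then show "AE x in lebesgue_on \<Omega>. norm ((\<phi> x)\<^sup>2) \<le> norm (B\<^sup>2 * indicator K x)"
      by (intro AE_I2) (auto simp: abs_mult)
  qed
  with m show ?thesis by (simp add: L2_def)
qed

lemma partial_test_function:
  assumes "\<phi> \<in> test_functions \<Omega>"
  shows "partial i \<phi> \<in> test_functions \<Omega>"
proof -
  obtain K where K: "K \<subseteq> \<Omega>" "compact K" "\<And>x. x \<notin> K \<Longrightarrow> \<phi> x = 0"
    and d: "\<And>k. differentiable_times k \<phi>"
    using assms unfolding test_functions_def by blast
  have "partial i \<phi> x = 0" if "x \<notin> K" for x
  proof -
    have "(\<phi> has_derivative (\<lambda>v. 0)) (at x)"
      by (rule has_derivative_transform_within_open[OF has_derivative_const, of "- K"])
         (use K that in \<open>auto intro: open_Compl compact_imp_closed\<close>)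
    then show ?thesis by (rule partial_eq)
  qed
  moreover have "differentiable_times k (partial i \<phi>)" for k
    using d[of "Suc k"] by simp
  ultimately show ?thesis
    using K unfolding test_functions_def by blast
qed

lemma weak_gradient_component_L2:
  assumes "weak_gradient \<Omega> v g"
  shows "(\<lambda>x. g x $ i) \<in> L2 \<Omega>"
proof -
  have g [measurable]: "g \<in> borel_measurable (lebesgue_on \<Omega>)"
    and g2: "integrable (lebesgue_on \<Omega>) (\<lambda>x. (norm (g x))\<^sup>2)"
    using assms by (auto simp: weak_gradient_def)
  have "(\<lambda>x. g x \<bullet> axis i 1) \<in> borel_measurable (lebesgue_on \<Omega>)" by measurable
  then have m: "(\<lambda>x. g x $ i) \<in> borel_measurable (lebesgue_on \<Omega>)" by (simp add: inner_axis)
  have "integrable (lebesgue_on \<Omega>) (\<lambda>x. (g x $ i)\<^sup>2)"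
  proof (rule Bochner_Integration.integrable_bound[OF g2])
    show "(\<lambda>x. (g x $ i)\<^sup>2) \<in> borel_measurable (lebesgue_on \<Omega>)" using m by simp
    have "\<bar>g x $ i\<bar>\<^sup>2 \<le> (norm (g x))\<^sup>2" for x
      by (intro power_mono component_le_norm_cart) simp
    then show "AE x in lebesgue_on \<Omega>. norm ((g x $ i)\<^sup>2) \<le> norm ((norm (g x))\<^sup>2)" by simp
  qed
  with m show ?thesis by (simp add: L2_def)
qed

lemma weak_gradient_lincomb:
  assumes "open \<Omega>" "v \<in> L2 \<Omega>" "w \<in> L2 \<Omega>" and g: "weak_gradient \<Omega> v g" and h: "weak_gradient \<Omega> w h"
  shows "weak_gradient \<Omega> (\<lambda>x. a * v x + b * w x) (\<lambda>x. a *\<^sub>R g x + b *\<^sub>R h x)"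
  unfolding weak_gradient_def
proof (intro conjI ballI allI)
  let ?M = "lebesgue_on \<Omega>"
  have [measurable]: "g \<in> borel_measurable ?M" "h \<in> borel_measurable ?M"
    and g2: "integrable ?M (\<lambda>x. (norm (g x))\<^sup>2)" and h2: "integrable ?M (\<lambda>x. (norm (h x))\<^sup>2)"
    using g h by (auto simp: weak_gradient_def)
  show "(\<lambda>x. a *\<^sub>R g x + b *\<^sub>R h x) \<in> borel_measurable ?M" by measurable
  show "integrable ?M (\<lambda>x. (norm (a *\<^sub>R g x + b *\<^sub>R h x))\<^sup>2)"
  proof (rule Bochner_Integration.integrable_bound)
    show "integrable ?M (\<lambda>x. 2 * (a\<^sup>2 * (norm (g x))\<^sup>2 + b\<^sup>2 * (norm (h x))\<^sup>2))" using g2 h2 by simp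
    show "(\<lambda>x. (norm (a *\<^sub>R g x + b *\<^sub>R h x))\<^sup>2) \<in> borel_measurable ?M" by measurable
    have "(norm (a *\<^sub>R g x + b *\<^sub>R h x))\<^sup>2 \<le> 2 * (a\<^sup>2 * (norm (g x))\<^sup>2 + b\<^sup>2 * (norm (h x))\<^sup>2)" for x
    proof -
      have "(norm (a *\<^sub>R g x + b *\<^sub>R h x))\<^sup>2 \<le> (norm (a *\<^sub>R g x) + norm (b *\<^sub>R h x))\<^sup>2"
        by (intro power_mono norm_triangle_ineq) simp
      also have "\<dots> \<le> 2 * ((norm (a *\<^sub>R g x))\<^sup>2 + (norm (b *\<^sub>R h x))\<^sup>2)"
        using sum_squares_bound[of "norm (a *\<^sub>R g x)" "norm (b *\<^sub>R h x)"] by (simp add: power2_sum)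
      finally show ?thesis by (simp add: power_mult_distrib)
    qed
    then show "AE x in ?M. norm ((norm (a *\<^sub>R g x + b *\<^sub>R h x))\<^sup>2) \<le>
        norm (2 * (a\<^sup>2 * (norm (g x))\<^sup>2 + b\<^sup>2 * (norm (h x))\<^sup>2))"
      by (intro AE_I2) (simp add: order_trans[OF _ abs_ge_self])
  qed
next
  fix \<phi> i assume \<phi>: "\<phi> \<in> test_functions \<Omega>"
  let ?p = "partial i \<phi>"
  have L: "\<phi> \<in> L2 \<Omega>" "?p \<in> L2 \<Omega>"
    using \<phi> partial_test_function[OF \<phi>] assms(1) by (auto intro: test_function_in_L2)
  have "L2_inner \<Omega> (\<lambda>x. a * v x + b * w x) ?p = a * L2_inner \<Omega> v ?p + b * L2_inner \<Omega> w ?p"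
    by (rule L2_inner_lincomb[OF assms(2,3) L(2)])
  moreover have "L2_inner \<Omega> (\<lambda>x. a * g x $ i + b * h x $ i) \<phi>
      = a * L2_inner \<Omega> (\<lambda>x. g x $ i) \<phi> + b * L2_inner \<Omega> (\<lambda>x. h x $ i) \<phi>"
    by (rule L2_inner_lincomb[OF weak_gradient_component_L2[OF g] weak_gradient_component_L2[OF h] L(1)])
  moreover have "L2_inner \<Omega> v ?p = - L2_inner \<Omega> (\<lambda>x. g x $ i) \<phi>"
      "L2_inner \<Omega> w ?p = - L2_inner \<Omega> (\<lambda>x. h x $ i) \<phi>"
    using g h \<phi> by (auto simp: weak_gradient_def L2_inner_def)
  ultimately show "(LINT x|lebesgue_on \<Omega>. (a * v x + b * w x) * partial i \<phi> x) =
      - (LINT x|lebesgue_on \<Omega>. (a *\<^sub>R g x + b *\<^sub>R h x) $ i * \<phi> x)"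
    by (simp add: L2_inner_def)
qed

text \<open>
  The components of the difference of two weak gradients are orthogonal to all test functions.
\<close>

lemma weak_gradient_unique:
  assumes "open \<Omega>" and g: "weak_gradient \<Omega> v g" and h: "weak_gradient \<Omega> v h"
  shows "AE x in lebesgue_on \<Omega>. g x = h x"
proof -
  have "AE x in lebesgue_on \<Omega>. 1 * g x $ i + (- 1) * h x $ i = 0" for i
  proof (rule fundamental_lemma_of_variations[OF assms(1)])
    let ?d = "\<lambda>x. 1 * g x $ i + (- 1) * h x $ i"
    note L = weak_gradient_component_L2[OF g, of i] weak_gradient_component_L2[OF h, of i]
    have "?d \<in> L2 \<Omega>" by (rule L2_lincomb[OF L])
    then show "?d \<in> borel_measurable (lebesgue_on \<Omega>)" "integrable (lebesgue_on \<Omega>) (\<lambda>x. (?d x)\<^sup>2)"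
      by (auto simp: L2_def)
    fix \<phi> assume \<phi>: "\<phi> \<in> test_functions \<Omega>"
    have "L2_inner \<Omega> ?d \<phi> = 1 * L2_inner \<Omega> (\<lambda>x. g x $ i) \<phi> + (- 1) * L2_inner \<Omega> (\<lambda>x. h x $ i) \<phi>"
      by (rule L2_inner_lincomb[OF L test_function_in_L2[OF \<phi> assms(1)]])
    also have "\<dots> = 0"
      using g h \<phi> by (simp add: weak_gradient_def L2_inner_def)
    finally show "(LINT x|lebesgue_on \<Omega>. ?d x * \<phi> x) = 0" by (simp add: L2_inner_def)
  qed
  then have "AE x in lebesgue_on \<Omega>. \<forall>i. 1 * g x $ i + (- 1) * h x $ i = 0"
    unfolding AE_all_countable by (rule allI)
  then show ?thesis
    by (rule eventually_mono) (simp add: vec_eq_iff)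
qed

lemma weak_gradient_grad: "v \<in> H1 \<Omega> \<Longrightarrow> weak_gradient \<Omega> v (grad \<Omega> v)"
  unfolding H1_def grad_def using someI_ex[of "weak_gradient \<Omega> v"] by auto

lemma H1_lincomb:
  "open \<Omega> \<Longrightarrow> v \<in> H1 \<Omega> \<Longrightarrow> w \<in> H1 \<Omega> \<Longrightarrow> (\<lambda>x. a * v x + b * w x) \<in> H1 \<Omega>"
  using weak_gradient_lincomb[of \<Omega> v w] L2_lincomb[of v \<Omega> w] unfolding H1_def by blast

text \<open>
  \<open>grad\<close> selects one of the weak gradients, hence it is linear only up to null sets.
\<close>

lemma grad_lincomb:
  assumes "open \<Omega>" "v \<in> H1 \<Omega>" "w \<in> H1 \<Omega>"
  shows "AE x in lebesgue_on \<Omega>. grad \<Omega> (\<lambda>x. a * v x + b * w x) x = a *\<^sub>R grad \<Omega> v x + b *\<^sub>R grad \<Omega> w x"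
  by (rule weak_gradient_unique[OF assms(1) weak_gradient_grad[OF H1_lincomb[OF assms]]
        weak_gradient_lincomb[OF assms(1) assms(2,3)[THEN H1_subset_L2] assms(2,3)[THEN weak_gradient_grad]]])

section \<open>The elliptic operator\<close>

lemma bounded_bilinear_matrix_vector_mult:
  "bounded_bilinear ((*v) :: real^'n^'m \<Rightarrow> real^'n \<Rightarrow> real^'m)"
  unfolding bilinear_conv_bounded_bilinear[symmetric] bilinear_def
  by (auto intro!: linearI simp: matrix_vector_mult_def vec_eq_iff sum.distrib sum_distrib_left algebra_simps)

lemma borel_measurable_matrix_vector_mult [measurable (raw)]:
  fixes A :: "'a \<Rightarrow> real^'n^'m"
  assumes "A \<in> borel_measurable N" "\<xi> \<in> borel_measurable N"
  shows "(\<lambda>x. A x *v \<xi> x) \<in> borel_measurable N"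
  by (rule borel_measurable_continuous_Pair[OF assms])
     (intro bounded_bilinear.continuous_on[OF bounded_bilinear_matrix_vector_mult] continuous_intros)

text \<open>
  As the coefficients are bounded, each term is dominated by a product of two of the square
  integrable functions \<open>\<bar>u\<bar>\<close>, \<open>\<bar>v\<bar>\<close>, \<open>\<bar>\<nabla>u\<bar>\<close> and \<open>\<bar>\<nabla>v\<bar>\<close>.
\<close>

lemma ell_op_integrable:
  fixes \<Omega> :: "(real^'n) set" and L :: "'n coeffs"
  assumes ell: "elliptic \<Omega> L" and u: "u \<in> H1 \<Omega>" and v: "v \<in> H1 \<Omega>"
  shows "integrable (lebesgue_on \<Omega>) (\<lambda>x.
      (Acoef L x *v grad \<Omega> u x + u x *\<^sub>R dcoef L x) \<bullet> grad \<Omega> v x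
      + (bcoef L x \<bullet> grad \<Omega> u x + ccoef L x * u x) * v x)" (is "integrable ?M ?F")
proof -
  have [measurable]: "Acoef L \<in> borel_measurable ?M" "dcoef L \<in> borel_measurable ?M"
     "bcoef L \<in> borel_measurable ?M" "ccoef L \<in> borel_measurable ?M"
    using ell by (auto simp: elliptic_def)
  obtain C where C: "AE x in ?M. norm (Acoef L x) \<le> C \<and> norm (dcoef L x) \<le> C \<and>
                                 norm (bcoef L x) \<le> C \<and> \<bar>ccoef L x\<bar> \<le> C"
    using ell by (auto simp: elliptic_def)
  obtain K where K: "K \<ge> 0" "\<And>A \<xi>. norm ((A :: real^'n^'n) *v \<xi>) \<le> norm A * norm \<xi> * K"
    using bounded_bilinear.nonneg_bounded[OF bounded_bilinear_matrix_vector_mult] by blast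
  have [measurable]: "u \<in> borel_measurable ?M" "v \<in> borel_measurable ?M"
     "grad \<Omega> u \<in> borel_measurable ?M" "grad \<Omega> v \<in> borel_measurable ?M"
    and sq: "integrable ?M (\<lambda>x. (u x)\<^sup>2)" "integrable ?M (\<lambda>x. (v x)\<^sup>2)"
     "integrable ?M (\<lambda>x. (norm (grad \<Omega> u x))\<^sup>2)" "integrable ?M (\<lambda>x. (norm (grad \<Omega> v x))\<^sup>2)"
    using H1_subset_L2[OF u] H1_subset_L2[OF v] weak_gradient_grad[OF u] weak_gradient_grad[OF v]
    by (auto simp: L2_def weak_gradient_def)
  have int: "integrable ?M (\<lambda>x. C * K * (norm (grad \<Omega> u x) * norm (grad \<Omega> v x))
      + C * (\<bar>u x\<bar> * norm (grad \<Omega> v x)) + C * (norm (grad \<Omega> u x) * \<bar>v x\<bar>) + C * (\<bar>u x\<bar> * \<bar>v x\<bar>))"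
    (is "integrable ?M ?G")
    by (intro Bochner_Integration.integrable_add integrable_mult_right integrable_mult_of_square_integrable)
       (use sq in simp_all)
  show ?thesis
  proof (rule Bochner_Integration.integrable_bound[OF int])
    show "?F \<in> borel_measurable ?M" by measurable
    show "AE x in ?M. norm (?F x) \<le> norm (?G x)"
      using C
    proof eventually_elim
      case (elim x)
      let ?gu = "grad \<Omega> u x" and ?gv = "grad \<Omega> v x"
      have C0: "0 \<le> C" using elim norm_ge_zero order_trans by blast
      have "\<bar>(Acoef L x *v ?gu) \<bullet> ?gv\<bar> \<le> norm (Acoef L x *v ?gu) * norm ?gv"
        by (rule Cauchy_Schwarz_ineq2)
      also have "\<dots> \<le> (C * norm ?gu * K) * norm ?gv"
        using K elim by (intro mult_right_mono order_trans[OF K(2)]) auto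
      finally have 1: "\<bar>(Acoef L x *v ?gu) \<bullet> ?gv\<bar> \<le> C * K * (norm ?gu * norm ?gv)"
        by (simp add: mult_ac)
      have "\<bar>u x\<bar> * \<bar>dcoef L x \<bullet> ?gv\<bar> \<le> \<bar>u x\<bar> * (norm (dcoef L x) * norm ?gv)"
        by (intro mult_left_mono Cauchy_Schwarz_ineq2) simp
      also have "\<dots> \<le> \<bar>u x\<bar> * (C * norm ?gv)"
        using elim by (intro mult_left_mono mult_right_mono) auto
      finally have 2: "\<bar>(u x *\<^sub>R dcoef L x) \<bullet> ?gv\<bar> \<le> C * (\<bar>u x\<bar> * norm ?gv)"
        by (simp add: abs_mult mult_ac)
      have "\<bar>bcoef L x \<bullet> ?gu\<bar> * \<bar>v x\<bar> \<le> (norm (bcoef L x) * norm ?gu) * \<bar>v x\<bar>"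
        by (intro mult_right_mono Cauchy_Schwarz_ineq2) simp
      also have "\<dots> \<le> (C * norm ?gu) * \<bar>v x\<bar>"
        using elim by (intro mult_right_mono) auto
      finally have 3: "\<bar>(bcoef L x \<bullet> ?gu) * v x\<bar> \<le> C * (norm ?gu * \<bar>v x\<bar>)"
        by (simp add: abs_mult mult_ac)
      have "\<bar>ccoef L x\<bar> * (\<bar>u x\<bar> * \<bar>v x\<bar>) \<le> C * (\<bar>u x\<bar> * \<bar>v x\<bar>)"
        using elim by (intro mult_right_mono) auto
      then have 4: "\<bar>ccoef L x * u x * v x\<bar> \<le> C * (\<bar>u x\<bar> * \<bar>v x\<bar>)"
        by (simp add: abs_mult mult_ac)
      have "\<bar>p + q + (r + s)\<bar> \<le> P + Q + R + S"
        if "\<bar>p\<bar> \<le> P" "\<bar>q\<bar> \<le> Q" "\<bar>r\<bar> \<le> R" "\<bar>s\<bar> \<le> S" for p q r s P Q R S :: real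
        using that by linarith
      from this[OF 1 2 3 4] have "\<bar>?F x\<bar> \<le> ?G x"
        unfolding inner_add_left distrib_right .
      then show ?case by simp
    qed
  qed
qed

lemma ell_op_lincomb:
  fixes \<Omega> :: "(real^'n) set" and L :: "'n coeffs"
  assumes "open \<Omega>" and ell: "elliptic \<Omega> L" and u: "u \<in> H1 \<Omega>" and w: "w \<in> H1 \<Omega>" and v: "v \<in> H1 \<Omega>"
  shows "ell_op \<Omega> L (\<lambda>x. a * u x + b * w x) v = a * ell_op \<Omega> L u v + b * ell_op \<Omega> L w v"
proof -
  let ?M = "lebesgue_on \<Omega>" and ?z = "\<lambda>x. a * u x + b * w x"
  let ?F = "\<lambda>u x. (Acoef L x *v grad \<Omega> u x + u x *\<^sub>R dcoef L x) \<bullet> grad \<Omega> v x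
      + (bcoef L x \<bullet> grad \<Omega> u x + ccoef L x * u x) * v x"
  have z: "?z \<in> H1 \<Omega>" using assms by (intro H1_lincomb)
  note int = ell_op_integrable[OF ell u v] ell_op_integrable[OF ell w v] ell_op_integrable[OF ell z v]
  have "AE x in ?M. ?F ?z x = a * ?F u x + b * ?F w x"
    using grad_lincomb[OF assms(1) u w, of a b]
  proof eventually_elim
    case (elim x)
    show ?case
      unfolding elim matrix_vector_right_distrib matrix_vector_mult_scaleR inner_add_left inner_add_right
        scaleR_add_left inner_scaleR_left inner_scaleR_right
      by (simp only: algebra_simps)
  qed
  then have "integral\<^sup>L ?M (?F ?z) = integral\<^sup>L ?M (\<lambda>x. a * ?F u x + b * ?F w x)"
  proof (rule integral_cong_AE[rotated 2])
    show "?F ?z \<in> borel_measurable ?M" using int(3) by (rule borel_measurable_integrable)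
    show "(\<lambda>x. a * ?F u x + b * ?F w x) \<in> borel_measurable ?M"
      by (rule borel_measurable_integrable[OF Bochner_Integration.integrable_add[OF
            integrable_mult_right[OF int(1)] integrable_mult_right[OF int(2)]]])
  qed
  also have "\<dots> = a * integral\<^sup>L ?M (?F u) + b * integral\<^sup>L ?M (?F w)"
    using int(1,2) by simp
  finally show ?thesis unfolding ell_op_def .
qed

section \<open>Interpolation in time\<close>

lemma mesh_mono:
  assumes "is_mesh T M t" "i \<le> k" "k \<le> M"
  shows "t i \<le> t k"
  using assms(2,3)
proof (induction k rule: dec_induct)
  case (step n)
  have "\<forall>j\<in>{1..M}. t (j - 1) < t j" using assms(1) by (simp add: is_mesh_def)
  from bspec[OF this, of "Suc n"] step show ?case by simp
qed simp

lemma mesh_step_pos: "is_mesh T M t \<Longrightarrow> j \<in> {1..M} \<Longrightarrow> step t j > 0"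
  by (auto simp: is_mesh_def step_def)

lemma mesh_bounds: "is_mesh T M t \<Longrightarrow> j \<le> M \<Longrightarrow> 0 \<le> t j \<and> t j \<le> T"
  using mesh_mono[of T M t 0 j] mesh_mono[of T M t j M] by (auto simp: is_mesh_def)

lemma mesh_interval_exists:
  assumes "is_mesh T M t" "0 < s" "s \<le> T"
  obtains j where "j \<in> {1..M}" "t (j - 1) < s" "s \<le> t j"
proof -
  define j where "j = (LEAST j. s \<le> t j)"
  have "s \<le> t M" using assms by (simp add: is_mesh_def)
  then have "s \<le> t j" "j \<le> M" unfolding j_def by (rule LeastI, rule Least_le)
  moreover have "j \<noteq> 0" using \<open>s \<le> t j\<close> assms by (auto simp: is_mesh_def intro: ccontr)
  moreover have "\<not> s \<le> t (j - 1)" using not_less_Least[of "j - 1" "\<lambda>j. s \<le> t j"] \<open>j \<noteq> 0\<close> by (simp add: j_def)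
  ultimately show thesis by (intro that[of j]) auto
qed

text \<open>
  The ramp rises from 0 to 1 over the \<open>j\<close>-th interval.  Its derivative is a multiple of one
  indicator, which makes the integration in time trivial; the hat functions are differences
  of consecutive ramps.
\<close>

definition ramp :: "(nat \<Rightarrow> real) \<Rightarrow> nat \<Rightarrow> real \<Rightarrow> real" where
  "ramp t j s = max 0 (min 1 ((s - t (j - 1)) / step t j))"

definition pw_linear ::
    "nat \<Rightarrow> (nat \<Rightarrow> real) \<Rightarrow> (nat \<Rightarrow> real^'n \<Rightarrow> real) \<Rightarrow> real \<Rightarrow> real^'n \<Rightarrow> real" where
  "pw_linear M t U s x = U 0 x + (\<Sum>j=1..M. ramp t j s * (U j x - U (j - 1) x))"

lemma ramp_on_interval:
  assumes mesh: "is_mesh T M t" and j: "j \<in> {1..M}" and s: "t (j - 1) \<le> s" "s \<le> t j" and k: "k \<in> {1..M}"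
  shows "ramp t k s = (if k < j then 1 else if j < k then 0 else (s - t (j - 1)) / step t j)"
proof -
  have st: "0 < step t k" "0 < step t j" using mesh_step_pos[OF mesh] j k by auto
  consider "k < j" | "j < k" | "k = j" by linarith
  then show ?thesis
  proof cases
    case 1
    then have "t k \<le> t (j - 1)" using mesh_mono[OF mesh, of k "j - 1"] j by auto
    then have "1 \<le> (s - t (k - 1)) / step t k" using s st by (simp add: field_simps step_def)
    then show ?thesis using 1 by (simp add: ramp_def)
  next
    case 2
    then have "t j \<le> t (k - 1)" using mesh_mono[OF mesh, of j "k - 1"] k by auto
    then have "(s - t (k - 1)) / step t k \<le> 0" using s st by (simp add: divide_nonpos_pos)
    then show ?thesis using 2 by (simp add: ramp_def)
  next
    case 3
    have "0 \<le> (s - t (j - 1)) / step t j" "(s - t (j - 1)) / step t j \<le> 1"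
      using s st by (simp_all add: field_simps) (simp add: step_def)
    then show ?thesis using 3 by (simp add: ramp_def)
  qed
qed

lemma ramp_continuous: "is_mesh T M t \<Longrightarrow> j \<in> {1..M} \<Longrightarrow> continuous_on S (ramp t j)"
  unfolding ramp_def[abs_def] using mesh_step_pos[of T M t j] by (intro continuous_intros) auto

lemma pw_linear_on_interval:
  assumes mesh: "is_mesh T M t" and j: "j \<in> {1..M}" and s: "t (j - 1) \<le> s" "s \<le> t j"
  shows "pw_linear M t U s x = (1 - (t j - s) / step t j) * U j x + ((t j - s) / step t j) * U (j - 1) x"
proof -
  let ?\<theta> = "(s - t (j - 1)) / step t j"
  have "(\<Sum>k=1..M. ramp t k s * (U k x - U (k - 1) x))
      = (\<Sum>k=1..M. (if k < j then U k x - U (k - 1) x else 0)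
                 + (if k = j then ?\<theta> * (U j x - U (j - 1) x) else 0))"
    using ramp_on_interval[OF mesh j s] by (intro sum.cong) auto
  also have "\<dots> = (\<Sum>k=1..M. if k < j then U k x - U (k - 1) x else 0) + ?\<theta> * (U j x - U (j - 1) x)"
    using j by (simp add: sum.distrib)
  also have "(\<Sum>k=1..M. if k < j then U k x - U (k - 1) x else 0) = (\<Sum>k\<in>{Suc 0..j - 1}. U k x - U (k - 1) x)"
    by (rule sum.mono_neutral_cong_right) (use j in auto)
  also have "(\<Sum>k\<in>{Suc 0..j - 1}. U k x - U (k - 1) x) = U (j - 1) x - U 0 x"
    using sum_telescope''[of 0 "j - 1" "\<lambda>k. U k x"] by simp
  finally have "pw_linear M t U s x = U (j - 1) x + ?\<theta> * (U j x - U (j - 1) x)"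
    by (simp add: pw_linear_def)
  moreover have "?\<theta> = 1 - (t j - s) / step t j"
    using mesh_step_pos[OF mesh j] by (simp add: field_simps) (simp add: step_def)
  moreover have "a + (1 - \<theta>) * (b - a) = (1 - \<theta>) * b + \<theta> * a" for a b \<theta> :: real
    by (simp add: algebra_simps)
  ultimately show ?thesis by (simp only:)
qed

text \<open>
  Summation by parts turns the increments of \<open>U\<close> into the values of \<open>U\<close>.  The boundary values
  of \<open>r\<close> produce the two half hats at the ends of the mesh.
\<close>

lemma pw_linear_eq_basis_sum:
  assumes "r 0 = 1" "r (Suc M) = 0" "\<And>j. j \<in> {1..M} \<Longrightarrow> r j = ramp t j s"
  shows "pw_linear M t U s x = (\<Sum>i\<le>M. (r i - r (Suc i)) * U i x)"
proof -
  have "(\<Sum>i\<le>m. (r i - r (Suc i)) * U i x)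
      = r 0 * U 0 x + (\<Sum>j=1..m. r j * (U j x - U (j - 1) x)) - r (Suc m) * U m x" for m
    by (induction m) (simp_all add: algebra_simps)
  then show ?thesis
    using assms by (simp add: pw_linear_def)
qed

lemma pw_linear_in_piecewise_poly:
  assumes mesh: "is_mesh T M t"
  shows "pw_linear M t U \<in> piecewise_poly M t U"
proof -
  define r where "r i s = (if i = 0 then 1 else if i \<le> M then ramp t i s else 0)" for i s
  define c where "c i s = r i s - r (Suc i) s" for i s
  have cont: "continuous_on S (r i)" for S i
  proof (cases "i \<in> {1..M}")
    case True
    then have "r i = ramp t i" by (auto simp: r_def)
    then show ?thesis using ramp_continuous[OF mesh True] by simp
  next
    case False
    then have "r i = (\<lambda>s. if i = 0 then 1 else 0)" by (auto simp: r_def)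
    then show ?thesis by simp
  qed
  have rpoly: "\<exists>q. \<forall>s\<in>{t (j - 1)..t j}. r i s = poly q s" if j: "j \<in> {1..M}" for i j
  proof (cases "i \<in> {1..M}")
    case True
    have "r i s = poly (if i < j then 1 else if j < i then 0
        else smult (1 / step t j) [:- t (j - 1), 1:]) s" if "s \<in> {t (j - 1)..t j}" for s
      using ramp_on_interval[OF mesh j _ _ True, of s] that True by (auto simp: r_def diff_divide_distrib)
    then show ?thesis by blast
  next
    case False
    then have "r i s = poly (if i = 0 then 1 else 0) s" for s by (auto simp: r_def)
    then show ?thesis by blast
  qed
  have "continuous_on {0..t M} (c i)" for i
    unfolding c_def[abs_def] by (intro continuous_on_diff cont)
  moreover have "\<exists>q. \<forall>s\<in>{t (j - 1)..t j}. c i s = poly q s" if j: "j \<in> {1..M}" for i j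
  proof -
    obtain p q where "\<forall>s\<in>{t (j - 1)..t j}. r i s = poly p s" "\<forall>s\<in>{t (j - 1)..t j}. r (Suc i) s = poly q s"
      using rpoly[OF j] by blast
    then show ?thesis by (intro exI[of _ "p - q"]) (simp add: c_def)
  qed
  moreover have "pw_linear M t U s x = (\<Sum>i\<le>M. c i s * U i x)" for s x
    unfolding c_def by (rule pw_linear_eq_basis_sum) (auto simp: r_def)
  ultimately show ?thesis unfolding piecewise_poly_def by blast
qed

lemma L2_sum:
  assumes "finite A" "u \<in> L2 \<Omega>" "\<And>j. j \<in> A \<Longrightarrow> w j \<in> L2 \<Omega>"
  shows "(\<lambda>x. u x + (\<Sum>j\<in>A. c j * w j x)) \<in> L2 \<Omega>"
    and "v \<in> L2 \<Omega> \<Longrightarrow> L2_inner \<Omega> (\<lambda>x. u x + (\<Sum>j\<in>A. c j * w j x)) v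
       = L2_inner \<Omega> u v + (\<Sum>j\<in>A. c j * L2_inner \<Omega> (w j) v)"
proof -
  have "(\<lambda>x. u x + (\<Sum>j\<in>A. c j * w j x)) \<in> L2 \<Omega> \<and> (v \<in> L2 \<Omega> \<longrightarrow>
      L2_inner \<Omega> (\<lambda>x. u x + (\<Sum>j\<in>A. c j * w j x)) v
       = L2_inner \<Omega> u v + (\<Sum>j\<in>A. c j * L2_inner \<Omega> (w j) v))"
    using assms(1,3)
  proof (induction A rule: finite_induct)
    case empty
    then show ?case using assms(2) by simp
  next
    case (insert k A)
    let ?S = "\<lambda>x. u x + (\<Sum>j\<in>A. c j * w j x)"
    have eq: "(\<lambda>x. u x + (\<Sum>j\<in>insert k A. c j * w j x)) = (\<lambda>x. 1 * ?S x + c k * w k x)"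
      using insert by (auto simp: fun_eq_iff)
    have S: "?S \<in> L2 \<Omega>" "w k \<in> L2 \<Omega>" using insert by auto
    show ?case
      unfolding eq
      using L2_lincomb[OF S, of 1 "c k"] L2_inner_lincomb[OF S, of v 1 "c k"] insert by simp
  qed
  then show "(\<lambda>x. u x + (\<Sum>j\<in>A. c j * w j x)) \<in> L2 \<Omega>"
    "v \<in> L2 \<Omega> \<Longrightarrow> L2_inner \<Omega> (\<lambda>x. u x + (\<Sum>j\<in>A. c j * w j x)) v
       = L2_inner \<Omega> u v + (\<Sum>j\<in>A. c j * L2_inner \<Omega> (w j) v)" by auto
qed

text \<open>
  This identifies the derivative of the ramp as the indicator of the interval divided by its length.
\<close>

lemma measure_initial_part_of_interval:
  assumes mesh: "is_mesh T M t" and j: "j \<in> {1..M}"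
  shows "measure lebesgue ({0..s} \<inter> {t (j - 1)<..<t j}) = step t j * ramp t j s"
proof -
  have st: "0 < step t j" using mesh_step_pos[OF mesh j] .
  have t0: "0 \<le> t (j - 1)" using mesh_bounds[OF mesh, of "j - 1"] j by auto
  consider "s \<le> t (j - 1)" | "t (j - 1) < s" "s < t j" | "t j \<le> s" by linarith
  then show ?thesis
  proof cases
    case 1
    then have "{0..s} \<inter> {t (j - 1)<..<t j} = {}" by auto
    moreover have "(s - t (j - 1)) / step t j \<le> 0" using 1 st by (simp add: divide_nonpos_pos)
    ultimately show ?thesis by (simp add: ramp_def)
  next
    case 2
    then have eq: "{0..s} \<inter> {t (j - 1)<..<t j} = {t (j - 1)<..s}" using t0 by auto
    have "ramp t j s = (s - t (j - 1)) / step t j"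
      using 2 ramp_on_interval[OF mesh j _ _ j, of s] by simp
    then show ?thesis using 2 st unfolding eq by simp
  next
    case 3
    then have eq: "{0..s} \<inter> {t (j - 1)<..<t j} = {t (j - 1)<..<t j}" using t0 by auto
    have "1 \<le> (s - t (j - 1)) / step t j" using 3 st by (simp add: field_simps step_def)
    then have "ramp t j s = 1" by (simp add: ramp_def)
    then show ?thesis using st unfolding eq by (simp add: step_def)
  qed
qed

lemma delta_L2:
  assumes "U j \<in> L2 \<Omega>" "U (j - 1) \<in> L2 \<Omega>"
  shows "delta t U j \<in> L2 \<Omega>"
    and "v \<in> L2 \<Omega> \<Longrightarrow> L2_inner \<Omega> (delta t U j) v = (L2_inner \<Omega> (U j) v - L2_inner \<Omega> (U (j - 1)) v) / step t j"
proof -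
  have eq: "delta t U j = (\<lambda>x. (1 / step t j) * U j x + (- (1 / step t j)) * U (j - 1) x)"
    by (auto simp: delta_def diff_divide_distrib)
  show "delta t U j \<in> L2 \<Omega>" unfolding eq by (rule L2_lincomb[OF assms])
  show "L2_inner \<Omega> (delta t U j) v = (L2_inner \<Omega> (U j) v - L2_inner \<Omega> (U (j - 1)) v) / step t j"
    if "v \<in> L2 \<Omega>"
    unfolding eq L2_inner_lincomb[OF assms that] by (simp add: diff_divide_distrib)
qed

text \<open>
  The time derivative of \<open>pw_linear M t U\<close>, with value 0 at the mesh points.
\<close>

definition pw_const ::
    "nat \<Rightarrow> (nat \<Rightarrow> real) \<Rightarrow> (nat \<Rightarrow> real^'n \<Rightarrow> real) \<Rightarrow> real \<Rightarrow> real^'n \<Rightarrow> real" where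
  "pw_const M t U s x = (\<Sum>j=1..M. indicator {t (j - 1)<..<t j} s * delta t U j x)"

lemma pw_const_on_interval:
  assumes mesh: "is_mesh T M t" and j: "j \<in> {1..M}" and s: "s \<in> {t (j - 1)<..<t j}"
  shows "pw_const M t U s = delta t U j"
proof
  fix x
  have ind: "indicator {t (k - 1)<..<t k} s = (if k = j then 1 else 0 :: real)" if k: "k \<in> {1..M}" for k
  proof (cases k j rule: linorder_cases)
    case less
    then have "t k \<le> t (j - 1)" using mesh_mono[OF mesh, of k "j - 1"] j by auto
    then show ?thesis using s less by (auto simp: indicator_def)
  next
    case greater
    then have "t j \<le> t (k - 1)" using mesh_mono[OF mesh, of j "k - 1"] k by auto
    then show ?thesis using s greater by (auto simp: indicator_def)
  qed (use s in auto)
  have "pw_const M t U s x = (\<Sum>k=1..M. if k = j then delta t U k x else 0)"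
    unfolding pw_const_def by (intro sum.cong) (auto simp: ind[unfolded One_nat_def])
  then show "pw_const M t U s x = delta t U j x" using j by simp
qed

lemma pw_linear_has_time_deriv:
  assumes mesh: "is_mesh T M t" and U: "\<And>j. j \<le> M \<Longrightarrow> U j \<in> L2 \<Omega>"
  shows "has_time_deriv \<Omega> T (pw_linear M t U) (\<lambda>s. L2_inner \<Omega> (pw_const M t U s))"
  unfolding has_time_deriv_def
proof (intro conjI ballI)
  have d: "delta t U j \<in> L2 \<Omega>" if "j \<in> {1..M}" for j
    using U that by (intro delta_L2) auto
  let ?w = "\<lambda>j x. U j x - U (j - 1) x"
  have w: "?w j \<in> L2 \<Omega>" if "j \<in> {1..M}" for j
    using that U by (intro L2_diff) auto
  show "pw_linear M t U s \<in> L2 \<Omega>" for s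
    unfolding pw_linear_def[abs_def] by (rule L2_sum) (use U w in auto)
  have zero: "(\<lambda>x. 0) \<in> L2 \<Omega>" by (simp add: L2_def)
  have pw: "pw_const M t U s = (\<lambda>x. 0 + (\<Sum>j=1..M. indicator {t (j - 1)<..<t j} s * delta t U j x))" for s
    by (auto simp: pw_const_def)
  have "L2_inner \<Omega> (pw_const M t U s) \<in> Hm1 \<Omega>" for s
    unfolding pw by (intro L2_inner_in_Hm1 L2_sum zero d) auto
  then show "AE s in lebesgue_on {0..T}. L2_inner \<Omega> (pw_const M t U s) \<in> Hm1 \<Omega>" by simp
  fix v assume v: "v \<in> H01 \<Omega>"
  have inner: "L2_inner \<Omega> (pw_const M t U s) v
      = (\<Sum>j=1..M. indicator {t (j - 1)<..<t j} s * L2_inner \<Omega> (delta t U j) v)" for s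
  proof -
    have "L2_inner \<Omega> (pw_const M t U s) v = L2_inner \<Omega> (\<lambda>x. 0) v
      + (\<Sum>j=1..M. indicator {t (j - 1)<..<t j} s * L2_inner \<Omega> (delta t U j) v)"
      unfolding pw by (rule L2_sum(2)) (use zero d H01_subset_L2[OF v] in auto)
    then show ?thesis by (simp add: L2_inner_def)
  qed
  have I: "has_bochner_integral lebesgue
      (\<lambda>s. indicator {0..s'} s *\<^sub>R L2_inner \<Omega> (pw_const M t U s) v)
      (\<Sum>j=1..M. step t j * ramp t j s' * L2_inner \<Omega> (delta t U j) v)" for s'
  proof -
    have "has_bochner_integral lebesgue (\<lambda>s. \<Sum>j=1..M. indicator ({0..s'} \<inter> {t (j - 1)<..<t j}) s * L2_inner \<Omega> (delta t U j) v)
      (\<Sum>j=1..M. step t j * ramp t j s' * L2_inner \<Omega> (delta t U j) v)"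
    proof (intro has_bochner_integral_sum has_bochner_integral_mult_left)
      fix j assume j: "j \<in> {1..M}"
      have "{0..s'} \<inter> {t (j - 1)<..<t j} \<in> lmeasurable" by (intro bounded_set_imp_lmeasurable) auto
      then have "has_bochner_integral lebesgue (indicator ({0..s'} \<inter> {t (j - 1)<..<t j}))
          (measure lebesgue ({0..s'} \<inter> {t (j - 1)<..<t j}))"
        by (intro has_bochner_integral_real_indicator) (auto simp: fmeasurable_def simp del: emeasure_completion)
      then show "has_bochner_integral lebesgue (indicator ({0..s'} \<inter> {t (j - 1)<..<t j})) (step t j * ramp t j s')"
        unfolding measure_initial_part_of_interval[OF mesh j] .
    qed
    moreover have "(\<Sum>j=1..M. indicator ({0..s'} \<inter> {t (j - 1)<..<t j}) s * L2_inner \<Omega> (delta t U j) v)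
        = indicator {0..s'} s *\<^sub>R L2_inner \<Omega> (pw_const M t U s) v" for s
      by (simp only: inner real_scaleR_def sum_distrib_left indicator_inter_arith mult.assoc)
    ultimately show ?thesis by simp
  qed
  show "set_integrable lebesgue {0..T} (\<lambda>s. L2_inner \<Omega> (pw_const M t U s) v)"
    unfolding set_integrable_def using I by (rule integrable.intros)
  fix s assume "s \<in> {0..T}"
  have lin: "L2_inner \<Omega> (pw_linear M t U s) v
      = L2_inner \<Omega> (U 0) v + (\<Sum>j=1..M. ramp t j s * L2_inner \<Omega> (?w j) v)" for s
    unfolding pw_linear_def[abs_def] by (rule L2_sum) (use U w H01_subset_L2[OF v] in auto)
  have increment: "ramp t j s * L2_inner \<Omega> (?w j) v = step t j * ramp t j s * L2_inner \<Omega> (delta t U j) v"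
    if j: "j \<in> {1..M}" for j
  proof -
    have Uj: "U j \<in> L2 \<Omega>" "U (j - 1) \<in> L2 \<Omega>" using U j by auto
    have "L2_inner \<Omega> (?w j) v = L2_inner \<Omega> (U j) v - L2_inner \<Omega> (U (j - 1)) v"
      using U j H01_subset_L2[OF v] by (intro L2_diff) auto
    then show ?thesis
      using delta_L2(2)[OF Uj H01_subset_L2[OF v], of t] mesh_step_pos[OF mesh j] by simp
  qed
  have "L2_inner \<Omega> (pw_linear M t U s) v = L2_inner \<Omega> (U 0) v
      + (\<Sum>j=1..M. step t j * ramp t j s * L2_inner \<Omega> (delta t U j) v)"
    unfolding lin by (simp only: increment cong: sum.cong)
  moreover have "L2_inner \<Omega> (pw_linear M t U 0) v = L2_inner \<Omega> (U 0) v"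
  proof -
    have "ramp t j 0 = 0" if j: "j \<in> {1..M}" for j
    proof -
      have "j - 1 \<le> M" using j by auto
      then have "(0 - t (j - 1)) / step t j \<le> 0"
        using mesh_bounds[OF mesh] mesh_step_pos[OF mesh j] by (intro divide_nonpos_pos) auto
      then show ?thesis by (simp add: ramp_def)
    qed
    then show ?thesis unfolding lin by simp
  qed
  ultimately show "L2_inner \<Omega> (pw_linear M t U s) v =
      L2_inner \<Omega> (pw_linear M t U 0) v + (LINT s:{0..s}|lebesgue. L2_inner \<Omega> (pw_const M t U s) v)"
    using has_bochner_integral_integral_eq[OF I[of s]] by (simp add: set_lebesgue_integral_def)
qed

lemma has_time_deriv_diff:
  assumes w: "has_time_deriv \<Omega> T w dw" and z: "has_time_deriv \<Omega> T z dz" and "0 \<le> T"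
  shows "has_time_deriv \<Omega> T (\<lambda>s x. w s x - z s x) (\<lambda>s v. dw s v - dz s v)"
  unfolding has_time_deriv_def
proof (intro conjI ballI)
  show "(\<lambda>x. w s x - z s x) \<in> L2 \<Omega>" if "s \<in> {0..T}" for s
    using that w z by (intro L2_diff) (auto simp: has_time_deriv_def)
  have "AE s in lebesgue_on {0..T}. dw s \<in> Hm1 \<Omega>" "AE s in lebesgue_on {0..T}. dz s \<in> Hm1 \<Omega>"
    using w z by (auto simp: has_time_deriv_def)
  then show "AE s in lebesgue_on {0..T}. (\<lambda>v. dw s v - dz s v) \<in> Hm1 \<Omega>"
    by eventually_elim (rule Hm1_diff)
  fix v assume v: "v \<in> H01 \<Omega>"
  have int: "set_integrable lebesgue {0..T} (\<lambda>s. dw s v)" "set_integrable lebesgue {0..T} (\<lambda>s. dz s v)"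
    using w z v by (auto simp: has_time_deriv_def)
  show "set_integrable lebesgue {0..T} (\<lambda>s. dw s v - dz s v)"
    using int by (rule set_integral_diff)
  fix s assume s: "s \<in> {0..T}"
  have "L2_inner \<Omega> (\<lambda>x. w r x - z r x) v = L2_inner \<Omega> (w r) v - L2_inner \<Omega> (z r) v" if "r \<in> {0..T}" for r
    using w z v that by (intro L2_diff) (auto simp: has_time_deriv_def H01_subset_L2)
  moreover have "set_integrable lebesgue {0..s} (\<lambda>s. dw s v)" "set_integrable lebesgue {0..s} (\<lambda>s. dz s v)"
    by (rule set_integrable_subset[OF int(1)] set_integrable_subset[OF int(2)]; use s in auto)+
  then have "(LINT r:{0..s}|lebesgue. dw r v - dz r v)
      = (LINT r:{0..s}|lebesgue. dw r v) - (LINT r:{0..s}|lebesgue. dz r v)"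
    by (rule set_integral_diff)
  moreover have "L2_inner \<Omega> (w s) v = L2_inner \<Omega> (w 0) v + (LINT r:{0..s}|lebesgue. dw r v)"
      "L2_inner \<Omega> (z s) v = L2_inner \<Omega> (z 0) v + (LINT r:{0..s}|lebesgue. dz r v)"
    using w z v s unfolding has_time_deriv_def by blast+
  ultimately show "L2_inner \<Omega> (\<lambda>x. w s x - z s x) v =
      L2_inner \<Omega> (\<lambda>x. w 0 x - z 0 x) v + (LINT r:{0..s}|lebesgue. dw r v - dz r v)"
    using s \<open>0 \<le> T\<close> by simp
qed

section \<open>The residual of the interpolated discrete solution\<close>

text \<open>
  For \<open>j = 0\<close> this is the definition of \<open>\<delta>\<^sub>t U\<^sup>0\<close>.
\<close>

lemma ell_op_backward_euler:
  assumes euler: "backward_euler \<Omega> L M t f u0 U" and "j \<le> M" and v: "v \<in> H01 \<Omega>"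
  shows "ell_op \<Omega> L (U j) v = L2_inner \<Omega> (f (t j)) v - deltaU \<Omega> L t f U j v"
  using assms unfolding backward_euler_def deltaU_def by (cases "j = 0") (auto simp: eq_diff_eq add.commute)

text \<open>
  With \<open>\<theta> = (t\<^sub>j - s) / \<tau>\<^sub>j\<close>, the elliptic operator maps \<open>(1 - \<theta>) U\<^sup>j + \<theta> U\<^sup>j\<^sup>-\<^sup>1\<close> to
  \<open>(1 - \<theta>) (f\<^sup>j - \<delta>\<^sub>t U\<^sup>j) + \<theta> (f\<^sup>j\<^sup>-\<^sup>1 - \<delta>\<^sub>t U\<^sup>j\<^sup>-\<^sup>1) = fhat(s) - \<delta>\<^sub>t U\<^sup>j + \<theta> (\<delta>\<^sub>t U\<^sup>j - \<delta>\<^sub>t U\<^sup>j\<^sup>-\<^sup>1)\<close>.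
  The term \<open>\<delta>\<^sub>t U\<^sup>j\<close> cancels against the time derivative of the interpolant.  The number \<open>l\<close> stands for
  the value at \<open>v\<close> of the weak time derivative of the exact solution \<open>z\<close> at time \<open>s\<close>.
\<close>

lemma residual_eq:
  fixes \<Omega> :: "(real^'n) set" and L :: "'n coeffs"
  assumes \<Omega>: "open \<Omega>" and ell: "elliptic \<Omega> L" and mesh: "is_mesh T M t"
    and f: "\<And>s. s \<in> {0..T} \<Longrightarrow> f s \<in> L2 \<Omega>"
    and euler: "backward_euler \<Omega> L M t f u0 U"
    and j: "j \<in> {1..M}" and s: "s \<in> {t (j - 1)<..<t j}"
    and z: "z \<in> H1 \<Omega>" and v: "v \<in> H01 \<Omega>" and l: "l + ell_op \<Omega> L z v = L2_inner \<Omega> (f s) v"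
  shows "l - L2_inner \<Omega> (pw_const M t U s) v + ell_op \<Omega> L (\<lambda>x. z x - pw_linear M t U s x) v
    = L2_inner \<Omega> (\<lambda>x. f s x - fhat t f j s x) v - (t j - s) * delta2U \<Omega> L t f U j v"
proof -
  define \<theta> where "\<theta> = (t j - s) / step t j"
  have st: "step t j > 0" using mesh_step_pos[OF mesh j] .
  have U: "U i \<in> H1 \<Omega>" if "i \<le> M" for i
    using euler that by (auto simp: backward_euler_def H01_subset_H1)
  have v1: "v \<in> H1 \<Omega>" and v2: "v \<in> L2 \<Omega>" using v by (auto simp: H01_subset_H1 H01_subset_L2)
  have UU: "U j \<in> H1 \<Omega>" "U (j - 1) \<in> H1 \<Omega>" using U j by auto
  have lin: "pw_linear M t U s = (\<lambda>x. (1 - \<theta>) * U j x + \<theta> * U (j - 1) x)"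
    using pw_linear_on_interval[OF mesh j, of s] s by (auto simp: \<theta>_def)
  have E: "ell_op \<Omega> L (pw_linear M t U s) v = (1 - \<theta>) * ell_op \<Omega> L (U j) v + \<theta> * ell_op \<Omega> L (U (j - 1)) v"
    unfolding lin by (rule ell_op_lincomb[OF \<Omega> ell UU v1])
  have P: "pw_linear M t U s \<in> H1 \<Omega>"
    unfolding lin by (rule H1_lincomb[OF \<Omega> UU])
  have D: "ell_op \<Omega> L (\<lambda>x. z x - pw_linear M t U s x) v = ell_op \<Omega> L z v - ell_op \<Omega> L (pw_linear M t U s) v"
    using ell_op_lincomb[OF \<Omega> ell z P v1, of 1 "-1"] by simp
  have "j - 1 \<le> M" using j by auto
  then have tj: "t j \<in> {0..T}" "t (j - 1) \<in> {0..T}" "s \<in> {0..T}"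
    using mesh_bounds[OF mesh, of j] mesh_bounds[OF mesh, of "j - 1"] j s by auto
  note fs = f[OF tj(1)] f[OF tj(2)] f[OF tj(3)]
  have d: "delta t (\<lambda>i. f (t i)) j \<in> L2 \<Omega>" using fs by (intro delta_L2) auto
  have fh: "fhat t f j s = (\<lambda>x. 1 * f (t j) x + (- (t j - s)) * delta t (\<lambda>i. f (t i)) j x)"
    by (simp add: fhat_def fun_eq_iff algebra_simps)
  have fhL: "fhat t f j s \<in> L2 \<Omega>" unfolding fh by (rule L2_lincomb[OF fs(1) d])
  have "L2_inner \<Omega> (\<lambda>x. f s x - fhat t f j s x) v = L2_inner \<Omega> (f s) v - L2_inner \<Omega> (fhat t f j s) v"
    by (rule L2_diff(2)[OF fs(3) fhL v2])
  also have "L2_inner \<Omega> (fhat t f j s) v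
      = L2_inner \<Omega> (f (t j)) v - (t j - s) * L2_inner \<Omega> (delta t (\<lambda>i. f (t i)) j) v"
    unfolding fh L2_inner_lincomb[OF fs(1) d v2] by (simp add: algebra_simps)
  also have "(t j - s) * L2_inner \<Omega> (delta t (\<lambda>i. f (t i)) j) v
      = \<theta> * (L2_inner \<Omega> (f (t j)) v - L2_inner \<Omega> (f (t (j - 1))) v)"
    using delta_L2(2)[of "\<lambda>i. f (t i)" j \<Omega> v t] fs v2 by (simp add: \<theta>_def)
  finally have F: "L2_inner \<Omega> (\<lambda>x. f s x - fhat t f j s x) v = L2_inner \<Omega> (f s) v
      - (L2_inner \<Omega> (f (t j)) v - \<theta> * (L2_inner \<Omega> (f (t j)) v - L2_inner \<Omega> (f (t (j - 1))) v))" .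
  have dd: "(t j - s) * delta2U \<Omega> L t f U j v = \<theta> * (deltaU \<Omega> L t f U j v - deltaU \<Omega> L t f U (j - 1) v)"
    by (simp add: delta2U_def \<theta>_def)
  have dU: "L2_inner \<Omega> (pw_const M t U s) v = deltaU \<Omega> L t f U j v"
    using pw_const_on_interval[OF mesh j s, of U] j by (simp add: deltaU_def)
  have BE: "ell_op \<Omega> L (U j) v = L2_inner \<Omega> (f (t j)) v - deltaU \<Omega> L t f U j v"
    "ell_op \<Omega> L (U (j - 1)) v = L2_inner \<Omega> (f (t (j - 1))) v - deltaU \<Omega> L t f U (j - 1) v"
    using j by (auto intro!: ell_op_backward_euler[OF euler _ v])
  show ?thesis
    unfolding D E F dd dU BE l[symmetric] by (simp add: algebra_simps)
qed

section \<open>Pairing of the residual with the Green's function\<close>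

lemma nn_integral_mult_le_Linf_L1:
  assumes "v \<in> borel_measurable (lebesgue_on \<Omega>)"
  shows "(\<integral>\<^sup>+x. ennreal (norm (g x * v x)) \<partial>lebesgue_on \<Omega>) \<le> Linf_norm \<Omega> g * L1_norm \<Omega> v"
proof -
  have "(\<integral>\<^sup>+x. ennreal (norm (g x * v x)) \<partial>lebesgue_on \<Omega>)
      \<le> (\<integral>\<^sup>+x. Linf_norm \<Omega> g * ennreal \<bar>v x\<bar> \<partial>lebesgue_on \<Omega>)"
  proof (rule nn_integral_mono_AE)
    have "AE x in lebesgue_on \<Omega>. ennreal \<bar>g x\<bar> \<le> Linf_norm \<Omega> g"
      unfolding Linf_norm_def by (rule esssup_AE)
    then show "AE x in lebesgue_on \<Omega>. ennreal (norm (g x * v x)) \<le> Linf_norm \<Omega> g * ennreal \<bar>v x\<bar>"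
      by eventually_elim (simp add: abs_mult ennreal_mult mult_right_mono)
  qed
  also have "\<dots> = Linf_norm \<Omega> g * L1_norm \<Omega> v"
    unfolding L1_norm_def using assms by (intro nn_integral_cmult) simp
  finally show ?thesis .
qed

lemma Holder_L1_Linf:
  assumes "v \<in> borel_measurable (lebesgue_on \<Omega>)"
  shows "ennreal \<bar>L2_inner \<Omega> g v\<bar> \<le> Linf_norm \<Omega> g * L1_norm \<Omega> v"
proof (cases "integrable (lebesgue_on \<Omega>) (\<lambda>x. g x * v x)")
  case True
  have "ennreal \<bar>L2_inner \<Omega> g v\<bar> \<le> (\<integral>\<^sup>+x. ennreal (norm (g x * v x)) \<partial>lebesgue_on \<Omega>)"
    using integral_norm_bound_ennreal[OF True] by (simp add: L2_inner_def)
  also note nn_integral_mult_le_Linf_L1[OF assms]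
  finally show ?thesis .
qed (simp add: L2_inner_def not_integrable_integral_eq)

lemma integrable_mult_Linf_L1:
  assumes g: "g \<in> borel_measurable (lebesgue_on \<Omega>)" and v: "v \<in> borel_measurable (lebesgue_on \<Omega>)"
    and "Linf_norm \<Omega> g < \<infinity>" "L1_norm \<Omega> v < \<infinity>"
  shows "integrable (lebesgue_on \<Omega>) (\<lambda>x. g x * v x)"
proof (rule integrableI_bounded)
  show "(\<lambda>x. g x * v x) \<in> borel_measurable (lebesgue_on \<Omega>)" using g v by simp
  note nn_integral_mult_le_Linf_L1[OF v, of g]
  also have "Linf_norm \<Omega> g * L1_norm \<Omega> v < \<infinity>"
    using assms(3,4) by (simp add: ennreal_mult_less_top)
  finally show "(\<integral>\<^sup>+x. ennreal (norm (g x * v x)) \<partial>lebesgue_on \<Omega>) < \<infinity>" .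
qed

text \<open>
  Every bounded representing function is integrable against \<open>v\<close>, because \<open>v\<close> is in \<open>L\<^sub>1\<close>; hence it does
  represent \<open>l\<close> at \<open>v\<close>.  The positive upper bound \<open>c\<close> in place of the \<open>L\<^sub>1\<close> norm of \<open>v\<close> makes the
  estimate trivial when the norm of \<open>l\<close> is infinite, whereas infinity times zero is zero.
\<close>

lemma Hm1_Linf_norm_bound:
  assumes v: "v \<in> H01 \<Omega>" and c: "L1_norm \<Omega> v \<le> ennreal c" "c > 0"
  shows "ennreal \<bar>l v\<bar> \<le> Hm1_Linf_norm \<Omega> l * ennreal c"
proof -
  have vm: "v \<in> borel_measurable (lebesgue_on \<Omega>)"
    using H01_subset_L2[OF v] by (simp add: L2_def)
  have "ennreal \<bar>l v\<bar> / ennreal c \<le> Hm1_Linf_norm \<Omega> l"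
    unfolding Hm1_Linf_norm_def
  proof (rule Inf_greatest, safe)
    fix g assume g: "g \<in> borel_measurable (lebesgue_on \<Omega>)"
      and rep: "\<forall>v\<in>H01 \<Omega>. integrable (lebesgue_on \<Omega>) (\<lambda>x. g x * v x) \<longrightarrow> l v = L2_inner \<Omega> g v"
    show "ennreal \<bar>l v\<bar> / ennreal c \<le> Linf_norm \<Omega> g"
    proof (cases "Linf_norm \<Omega> g < \<infinity>")
      case True
      have "L1_norm \<Omega> v < \<infinity>" using c(1) by (auto intro: le_less_trans)
      then have "l v = L2_inner \<Omega> g v"
        using rep v integrable_mult_Linf_L1[OF g vm True] by blast
      then have "ennreal \<bar>l v\<bar> \<le> Linf_norm \<Omega> g * L1_norm \<Omega> v"
        using Holder_L1_Linf[OF vm] by simp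
      also have "\<dots> \<le> ennreal c * Linf_norm \<Omega> g"
        using c(1) by (subst mult.commute) (rule mult_right_mono, auto)
      finally show ?thesis using c(2) by (intro divide_le_posI_ennreal) auto
    qed (simp add: less_top[symmetric])
  qed
  then have "ennreal \<bar>l v\<bar> / ennreal c * ennreal c \<le> Hm1_Linf_norm \<Omega> l * ennreal c"
    by (rule mult_right_mono) simp
  moreover have "ennreal \<bar>l v\<bar> / ennreal c * ennreal c = ennreal \<bar>l v\<bar>"
    using c(2) by (simp add: divide_ennreal ennreal_mult'[symmetric])
  ultimately show ?thesis by simp
qed

lemma green_L1_bound:
  assumes "green_bounds \<Omega> T G \<kappa> \<kappa>' \<gamma>" "x \<in> \<Omega>" "\<kappa>' 0 = 0" "0 < r" "r \<le> T"
  shows "G x r \<in> borel_measurable (lebesgue_on \<Omega>)"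
    and "L1_norm \<Omega> (G x r) \<le> ennreal (\<kappa> 0 * exp (- \<gamma> * r))"
proof -
  have "x \<in> closure \<Omega>" using assms(2) closure_subset by blast
  then obtain D where "D 0 = G x" and D: "\<forall>p\<le>2. \<forall>t\<in>{0<..T}.
      D p t \<in> borel_measurable (lebesgue_on \<Omega>) \<and>
      L1_norm \<Omega> (D p t) \<le> ennreal ((\<kappa> p / t ^ p + \<kappa>' p) * exp (- \<gamma> * t))"
    using assms(1) unfolding green_bounds_def by blast
  then show "G x r \<in> borel_measurable (lebesgue_on \<Omega>)"
    and "L1_norm \<Omega> (G x r) \<le> ennreal (\<kappa> 0 * exp (- \<gamma> * r))"
    using D[rule_format, of 0 r] assms by auto
qed

text \<open>
  If \<open>\<kappa>\<^sub>0 = 0\<close>, then \<open>G x r\<close> vanishes almost everywhere for each \<open>r\<close> in \<open>{0<..T}\<close>, so that the Dirac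
  initial condition forces all test functions to be zero at \<open>x\<close>.
\<close>

lemma green_constant_pos:
  assumes green: "is_green \<Omega> L G" and bounds: "green_bounds \<Omega> T G \<kappa> \<kappa>' \<gamma>"
    and "open \<Omega>" "\<Omega> \<noteq> {}" "0 < T" "\<kappa>' 0 = 0" "0 \<le> \<kappa> 0"
  shows "0 < \<kappa> 0"
proof (rule ccontr)
  assume "\<not> 0 < \<kappa> 0"
  with assms have k0: "\<kappa> 0 = 0" by simp
  obtain x where x: "x \<in> \<Omega>" using assms by blast
  obtain \<phi> where \<phi>: "\<And>k. \<phi> k \<in> test_functions \<Omega>" "\<And>k x. 0 \<le> \<phi> k x \<and> \<phi> k x \<le> 1"
      "\<And>x. (\<lambda>k. \<phi> k x) \<longlonglongrightarrow> indicator \<Omega> x"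
    using open_indicator_limit_of_test_functions[OF \<open>open \<Omega>\<close>] by metis
  have zero: "L2_inner \<Omega> (G x r) (\<phi> k) = 0" if "0 < r" "r \<le> T" for r k
  proof -
    note m = green_L1_bound[OF bounds x \<open>\<kappa>' 0 = 0\<close> that]
    then have "(\<integral>\<^sup>+y. ennreal \<bar>G x r y\<bar> \<partial>lebesgue_on \<Omega>) = 0"
      by (simp add: L1_norm_def k0)
    then have "AE y in lebesgue_on \<Omega>. ennreal \<bar>G x r y\<bar> = 0"
      using m(1) by (subst (asm) nn_integral_0_iff_AE) auto
    then have "AE y in lebesgue_on \<Omega>. G x r y * \<phi> k y = 0"
      by eventually_elim auto
    then show ?thesis unfolding L2_inner_def by (rule integral_eq_zero_AE)
  qed
  have "\<phi> k x = 0" for k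
  proof -
    have "((\<lambda>r. L2_inner \<Omega> (G x r) (\<phi> k)) \<longlongrightarrow> \<phi> k x) (at_right 0)"
      using green x \<phi>(1) by (simp add: is_green_def)
    moreover have "((\<lambda>r. L2_inner \<Omega> (G x r) (\<phi> k)) \<longlongrightarrow> 0) (at_right 0)"
    proof (rule tendsto_eventually)
      have "\<forall>\<^sub>F r in at_right 0. r \<in> {0<..<T}"
        using \<open>0 < T\<close> by (rule eventually_at_right_real)
      then show "\<forall>\<^sub>F r in at_right 0. L2_inner \<Omega> (G x r) (\<phi> k) = 0"
        by eventually_elim (use zero in auto)
    qed
    ultimately show ?thesis by (rule tendsto_unique[OF trivial_limit_at_right_real])
  qed
  then have "(\<lambda>k. 0) \<longlonglongrightarrow> (1::real)" using \<phi>(3)[of x] x by simp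
  then show False by (simp add: LIMSEQ_const_iff)
qed

lemma residual_functional_bound:
  assumes v: "v \<in> H01 \<Omega>" and L1: "L1_norm \<Omega> v \<le> ennreal c" and c: "c > 0" and d: "0 \<le> d"
  shows "ennreal \<bar>L2_inner \<Omega> g v - d * l v\<bar> \<le> ennreal c * (Linf_norm \<Omega> g + ennreal d * Hm1_Linf_norm \<Omega> l)"
proof -
  have vm: "v \<in> borel_measurable (lebesgue_on \<Omega>)"
    using H01_subset_L2[OF v] by (simp add: L2_def)
  have "\<bar>L2_inner \<Omega> g v - d * l v\<bar> \<le> \<bar>L2_inner \<Omega> g v\<bar> + d * \<bar>l v\<bar>"
    using abs_triangle_ineq4[of "L2_inner \<Omega> g v" "d * l v"] d by (simp add: abs_mult)
  then have "ennreal \<bar>L2_inner \<Omega> g v - d * l v\<bar> \<le> ennreal (\<bar>L2_inner \<Omega> g v\<bar> + d * \<bar>l v\<bar>)"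
    by (rule ennreal_leI)
  also have "\<dots> = ennreal \<bar>L2_inner \<Omega> g v\<bar> + ennreal d * ennreal \<bar>l v\<bar>"
    using d by (simp add: ennreal_mult)
  also have "\<dots> \<le> Linf_norm \<Omega> g * ennreal c + ennreal d * (Hm1_Linf_norm \<Omega> l * ennreal c)"
    using Hm1_Linf_norm_bound[OF v L1 c, of l] L1
    by (intro add_mono mult_left_mono order_trans[OF Holder_L1_Linf[OF vm]]) auto
  finally show ?thesis by (simp add: distrib_left mult_ac)
qed

section \<open>Integration over the mesh\<close>

text \<open>
  The function \<open>F\<close> may fail to be measurable, so that additivity of the integral cannot be applied
  to \<open>F + G\<close>.  It is applied instead to \<open>h / C = (h / C - G) + G\<close>, where \<open>h / C - G \<le> F\<close>.  The finiteness
  of \<open>G\<close> is needed for the last inequality.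
\<close>

lemma nn_integral_le_of_sum_bound:
  assumes h: "h \<in> borel_measurable N" and G: "G \<in> borel_measurable N" and Gfin: "\<And>s. G s < \<infinity>"
    and C: "C > 0" and le: "AE s in N. h s \<le> ennreal C * (F s + G s)"
  shows "integral\<^sup>N N h \<le> ennreal C * (integral\<^sup>N N F + integral\<^sup>N N G)"
proof -
  let ?k = "\<lambda>s. h s / ennreal C"
  have k: "?k \<in> borel_measurable N" using h by simp
  have hk: "h s = ennreal C * ?k s" for s
    using C by (simp add: ennreal_times_divide ennreal_mult_divide_eq mult.commute[of "ennreal C"])
  have "integral\<^sup>N N h = ennreal C * integral\<^sup>N N ?k"
    unfolding nn_integral_cmult[OF k, symmetric] by (intro nn_integral_cong hk)
  also have "integral\<^sup>N N ?k \<le> (\<integral>\<^sup>+s. (?k s - G s) + G s \<partial>N)"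
    by (intro nn_integral_mono) (auto simp: diff_add_self_ennreal)
  also have "\<dots> = (\<integral>\<^sup>+s. ?k s - G s \<partial>N) + integral\<^sup>N N G"
    using k G by (intro nn_integral_add) simp_all
  also have "(\<integral>\<^sup>+s. ?k s - G s \<partial>N) \<le> integral\<^sup>N N F"
  proof (rule nn_integral_mono_AE)
    show "AE s in N. ?k s - G s \<le> F s"
      using le
    proof eventually_elim
      case (elim s)
      have "?k s \<le> F s + G s"
        using elim C by (intro divide_le_posI_ennreal) auto
      then show ?case
        using Gfin[of s] by (subst ennreal_minus_le_iff) (auto simp: add.commute less_top)
    qed
  qed
  finally show ?thesis by (simp add: mult_left_mono add_right_mono)
qed

lemma nn_integral_linear_weight:
  assumes "a \<le> (b::real)"
  shows "(\<integral>\<^sup>+s. ennreal (b - s) \<partial>lebesgue_on {a<..<b}) \<le> ennreal ((b - a)\<^sup>2 / 2)"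
proof -
  have "(\<integral>\<^sup>+s. ennreal (b - s) \<partial>lebesgue_on {a<..<b})
      = (\<integral>\<^sup>+s. ennreal (b - s) * indicator {a<..<b} s \<partial>lborel)"
    by (simp add: nn_integral_restrict_space nn_integral_completion)
  also have "\<dots> \<le> (\<integral>\<^sup>+s. ennreal (b - s) * indicator {a..b} s \<partial>lborel)"
    by (intro nn_integral_mono) (auto simp: indicator_def)
  also have "\<dots> = ennreal (- ((b - b)\<^sup>2 / 2) - (- ((b - a)\<^sup>2 / 2)))"
    using assms
    by (intro nn_integral_FTC_Icc[where F = "\<lambda>s. - ((b - s)\<^sup>2 / 2)"])
       (auto intro!: derivative_eq_intros simp: field_simps)
  finally show ?thesis by simp
qed

lemma nn_integral_interval_bound:
  assumes h: "h \<in> borel_measurable (lebesgue_on {a<..<b})" and "a < (b::real)" "C > 0"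
    and le: "AE s in lebesgue_on {a<..<b}. h s \<le> ennreal C * (F s + ennreal (b - s) * N)"
  shows "integral\<^sup>N (lebesgue_on {a<..<b}) h
    \<le> ennreal C * (integral\<^sup>N (lebesgue_on {a<..<b}) F + ennreal ((b - a)\<^sup>2 / 2) * N)"
proof (cases "N < \<infinity>")
  case True
  have m: "(\<lambda>s. ennreal (b - s)) \<in> borel_measurable (lebesgue_on {a<..<b})"
    by (intro measurable_restrict_space1 measurable_completion) simp
  have "integral\<^sup>N (lebesgue_on {a<..<b}) h \<le> ennreal C *
      (integral\<^sup>N (lebesgue_on {a<..<b}) F + (\<integral>\<^sup>+s. ennreal (b - s) * N \<partial>lebesgue_on {a<..<b}))"
    using True m by (intro nn_integral_le_of_sum_bound[OF h _ _ \<open>C > 0\<close> le]) (auto simp: ennreal_mult_less_top)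
  also have "(\<integral>\<^sup>+s. ennreal (b - s) * N \<partial>lebesgue_on {a<..<b}) \<le> ennreal ((b - a)\<^sup>2 / 2) * N"
    unfolding nn_integral_multc[OF m] using \<open>a < b\<close> by (intro mult_right_mono nn_integral_linear_weight) auto
  finally show ?thesis by (simp add: add_left_mono mult_left_mono)
next
  case False
  then have "N = \<infinity>" by (simp add: less_top[symmetric])
  \<comment> \<open>The weight of \<open>N\<close> is positive, so the right-hand side is infinite.\<close>
  moreover have "(b - a)\<^sup>2 / 2 > 0" using \<open>a < b\<close> by simp
  ultimately have "ennreal ((b - a)\<^sup>2 / 2) * N = \<infinity>"
    by (simp add: ennreal_mult_top)
  then show ?thesis using \<open>C > 0\<close> by (simp add: ennreal_mult_top)
qed

text \<open>
  The mesh points, which the open intervals leave out, form a null set.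
\<close>

lemma nn_integral_le_sum_over_mesh:
  assumes mesh: "is_mesh T M t" and h: "h \<in> borel_measurable lebesgue"
  shows "integral\<^sup>N (lebesgue_on {0<..<T}) h \<le> (\<Sum>j=1..M. integral\<^sup>N (lebesgue_on {t (j - 1)<..<t j}) h)"
proof -
  have "integral\<^sup>N (lebesgue_on {0<..<T}) h = (\<integral>\<^sup>+s. h s * indicator {0<..<T} s \<partial>lebesgue)"
    by (simp add: nn_integral_restrict_space)
  also have "\<dots> \<le> (\<integral>\<^sup>+s. (\<Sum>j=1..M. h s * indicator {t (j - 1)<..<t j} s) \<partial>lebesgue)"
  proof (rule nn_integral_mono_AE)
    have "finite (t ` {..M})" by simp
    then have "t ` {..M} \<in> null_sets lebesgue"
      using negligible_finite negligible_iff_null_sets by blast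
    then have "AE s in lebesgue. s \<notin> t ` {..M}" by (rule AE_not_in)
    then show "AE s in lebesgue. h s * indicator {0<..<T} s \<le> (\<Sum>j=1..M. h s * indicator {t (j - 1)<..<t j} s)"
    proof eventually_elim
      case (elim s)
      show ?case
      proof (cases "s \<in> {0<..<T}")
        case True
        then obtain j where j: "j \<in> {1..M}" "t (j - 1) < s" "s \<le> t j"
          using mesh_interval_exists[OF mesh, of s] by auto
        then have "s < t j" using elim by (auto simp: less_le)
        then have "h s * indicator {0<..<T} s = h s * indicator {t (j - 1)<..<t j} s"
          using True j by simp
        also have "\<dots> \<le> (\<Sum>j=1..M. h s * indicator {t (j - 1)<..<t j} s)"
          using j(1) by (intro member_le_sum) auto
        finally show ?thesis .
      qed simp
    qed
  qed
  also have "\<dots> = (\<Sum>j=1..M. \<integral>\<^sup>+s. h s * indicator {t (j - 1)<..<t j} s \<partial>lebesgue)"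
    using h by (intro nn_integral_sum borel_measurable_times_ennreal borel_measurable_indicator) auto
  finally show ?thesis by (simp add: nn_integral_restrict_space)
qed

theorem theorem4:
  fixes \<Omega> :: "(real^'n) set" and L :: "'n coeffs" and T \<gamma> :: real
    and G :: "real^'n \<Rightarrow> real \<Rightarrow> real^'n \<Rightarrow> real"
    and \<kappa> \<kappa>' :: "nat \<Rightarrow> real"
    and f u :: "real \<Rightarrow> real^'n \<Rightarrow> real" and u0 :: "real^'n \<Rightarrow> real"
    and M :: nat and t :: "nat \<Rightarrow> real" and U :: "nat \<Rightarrow> real^'n \<Rightarrow> real"
  assumes "lipschitz_domain \<Omega>" and "elliptic \<Omega> L" and "T > 0"
    and f: "\<And>s. s \<in> {0..T} \<Longrightarrow> f s \<in> L2 \<Omega>"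
    and green: "is_green \<Omega> L G"
    and representation: "\<And>w. w \<in> W11_H01 \<Omega> T \<Longrightarrow> green_representation \<Omega> L G T w"
    and "\<And>p. p \<le> 2 \<Longrightarrow> \<kappa> p \<ge> 0" and "\<And>p. p \<le> 2 \<Longrightarrow> \<kappa>' p \<ge> 0" and "\<kappa>' 0 = 0" and "\<gamma> \<ge> 0"
    and bounds: "green_bounds \<Omega> T G \<kappa> \<kappa>' \<gamma>"
    and mesh: "is_mesh T M t"
    and euler: "backward_euler \<Omega> L M t f u0 U"
    and solution: "weak_solution \<Omega> L T f u0 u"
    and regularity: "\<And>P. P \<in> piecewise_poly M t U \<Longrightarrow>
          green_representation \<Omega> L G T (\<lambda>s x. u s x - P s x)"
  shows "Linf_norm \<Omega> (\<lambda>x. u T x - U M x) \<le>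
    (\<Sum>j=1..M. ennreal (exp (- \<gamma> * (T - t j))) * (eta_f \<Omega> (\<kappa> 0) t f j + eta_d2U \<Omega> L (\<kappa> 0) t f U j))"
proof -
  have \<Omega>: "open \<Omega>" "\<Omega> \<noteq> {}" using assms(1) by (auto simp: lipschitz_domain_def)
  have \<kappa>: "0 < \<kappa> 0"
    using green_constant_pos[OF green bounds \<Omega> \<open>T > 0\<close> \<open>\<kappa>' 0 = 0\<close>] assms(7)[of 0] by simp
  have tM: "t 0 = 0" "t M = T" using mesh by (auto simp: is_mesh_def)
  then have "M \<noteq> 0" using \<open>T > 0\<close> by (metis less_irrefl)
  have U: "U j \<in> H01 \<Omega>" if "j \<le> M" for j using euler that by (simp add: backward_euler_def)
  define P where "P = pw_linear M t U"
  have P0: "P 0 x = U 0 x" for x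
    using pw_linear_on_interval[OF mesh, of 1 0 U x] mesh_step_pos[OF mesh, of 1] \<open>M \<noteq> 0\<close> tM
      mesh_bounds[OF mesh, of 1]
    by (simp add: P_def step_def)
  have PT: "P T x = U M x" for x
    using pw_linear_on_interval[OF mesh, of M T U x] \<open>M \<noteq> 0\<close> tM mesh_bounds[OF mesh, of "M - 1"]
    by (simp add: P_def)
  obtain du where du: "has_time_deriv \<Omega> T u du"
    and eqn: "AE s in lebesgue_on {0..T}. \<forall>v\<in>H01 \<Omega>. du s v + ell_op \<Omega> L (u s) v = L2_inner \<Omega> (f s) v"
    and u0: "AE x in lebesgue_on \<Omega>. u 0 x = u0 x" and uH: "\<And>s. s \<in> {0..T} \<Longrightarrow> u s \<in> H01 \<Omega>"
    using solution unfolding weak_solution_def by blast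
  define dw where "dw s v = du s v - L2_inner \<Omega> (pw_const M t U s) v" for s v
  have dw: "has_time_deriv \<Omega> T (\<lambda>s x. u s x - P s x) dw"
    unfolding dw_def[abs_def] P_def
    using U H01_subset_L2 \<open>T > 0\<close>
    by (intro has_time_deriv_diff[OF du] pw_linear_has_time_deriv[OF mesh]) auto
  \<comment> \<open>The integrand of the representation: the residual paired with the Green's function of \<open>x\<close>.\<close>
  define \<rho> where "\<rho> x s = dw s (G x (T - s)) + ell_op \<Omega> L (\<lambda>y. u s y - P s y) (G x (T - s))" for x s
  have "green_representation \<Omega> L G T (\<lambda>s x. u s x - P s x)"
    unfolding P_def by (rule regularity[OF pw_linear_in_piecewise_poly[OF mesh]])
  then have "AE x in lebesgue_on \<Omega>. set_integrable lebesgue {0<..<T} (\<rho> x) \<and>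
      u T x - P T x = L2_inner \<Omega> (G x T) (\<lambda>y. u 0 y - P 0 y) + (LINT s:{0<..<T}|lebesgue. \<rho> x s)"
    unfolding green_representation_def \<rho>_def using dw \<open>T > 0\<close> by auto
  moreover have "L2_inner \<Omega> g (\<lambda>y. u 0 y - P 0 y) = 0" for g
  proof -
    have "U 0 = u0" using euler by (simp add: backward_euler_def)
    then have "AE y in lebesgue_on \<Omega>. g y * (u 0 y - P 0 y) = 0"
      using u0 unfolding P0 by (auto elim: eventually_mono)
    then show ?thesis unfolding L2_inner_def by (rule integral_eq_zero_AE)
  qed
  ultimately have rep: "AE x in lebesgue_on \<Omega>. set_integrable lebesgue {0<..<T} (\<rho> x) \<and>
      u T x - U M x = (LINT s:{0<..<T}|lebesgue. \<rho> x s)"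
    unfolding PT by simp
  define F where "F j s = Linf_norm \<Omega> (\<lambda>x. f s x - fhat t f j s x)" for j s
  define N where "N j = Hm1_Linf_norm \<Omega> (delta2U \<Omega> L t f U j)" for j
  define C where "C j = \<kappa> 0 * exp (- \<gamma> * (T - t j))" for j
  have C: "C j > 0" for j using \<kappa> by (simp add: C_def)
  have \<rho>_bound: "AE s in lebesgue_on {t (j - 1)<..<t j}.
      ennreal \<bar>\<rho> x s\<bar> \<le> ennreal (C j) * (F j s + ennreal (t j - s) * N j)"
    if x: "x \<in> \<Omega>" and j: "j \<in> {1..M}" for x j
  proof -
    have "AE s in lebesgue. s \<in> {0..T} \<longrightarrow>
        (\<forall>v\<in>H01 \<Omega>. du s v + ell_op \<Omega> L (u s) v = L2_inner \<Omega> (f s) v)"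
      using eqn by (simp add: AE_restrict_space_iff)
    then have "AE s in lebesgue. s \<in> {t (j - 1)<..<t j} \<longrightarrow>
        ennreal \<bar>\<rho> x s\<bar> \<le> ennreal (C j) * (F j s + ennreal (t j - s) * N j)"
    proof (eventually_elim, intro impI)
      fix s assume eq: "s \<in> {0..T} \<longrightarrow> (\<forall>v\<in>H01 \<Omega>. du s v + ell_op \<Omega> L (u s) v = L2_inner \<Omega> (f s) v)"
        and s: "s \<in> {t (j - 1)<..<t j}"
      have "j - 1 \<le> M" "j \<le> M" using j by auto
      then have s': "0 < T - s" "T - s \<le> T" "s \<in> {0..T}"
        using s mesh_bounds[OF mesh, of "j - 1"] mesh_bounds[OF mesh, of j] by auto
      have GH: "G x (T - s) \<in> H01 \<Omega>" using green x s' by (simp add: is_green_def)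
      have "\<gamma> * (T - t j) \<le> \<gamma> * (T - s)" using s \<open>\<gamma> \<ge> 0\<close> by (intro mult_left_mono) auto
      then have "\<kappa> 0 * exp (- \<gamma> * (T - s)) \<le> C j"
        unfolding C_def using \<kappa> by (intro mult_left_mono) auto
      then have GL: "L1_norm \<Omega> (G x (T - s)) \<le> ennreal (C j)"
        using green_L1_bound(2)[OF bounds x \<open>\<kappa>' 0 = 0\<close> s'(1,2)] ennreal_leI order_trans by blast
      have "\<rho> x s = L2_inner \<Omega> (\<lambda>x. f s x - fhat t f j s x) (G x (T - s))
          - (t j - s) * delta2U \<Omega> L t f U j (G x (T - s))"
        unfolding \<rho>_def dw_def P_def
        using eq s' GH
        by (intro residual_eq[OF \<Omega>(1) assms(2) mesh f euler j s H01_subset_H1[OF uH] GH]) auto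
      then show "ennreal \<bar>\<rho> x s\<bar> \<le> ennreal (C j) * (F j s + ennreal (t j - s) * N j)"
        unfolding F_def N_def using residual_functional_bound[OF GH GL C] s by simp
    qed
    then show ?thesis by (simp add: AE_restrict_space_iff)
  qed
  have bound: "ennreal \<bar>u T x - U M x\<bar>
      \<le> (\<Sum>j=1..M. ennreal (exp (- \<gamma> * (T - t j))) * (eta_f \<Omega> (\<kappa> 0) t f j + eta_d2U \<Omega> L (\<kappa> 0) t f U j))"
    if x: "x \<in> \<Omega>" and int: "set_integrable lebesgue {0<..<T} (\<rho> x)"
      and eq: "u T x - U M x = (LINT s:{0<..<T}|lebesgue. \<rho> x s)" for x
  proof -
    \<comment> \<open>The indicator makes \<open>h\<close> measurable on the whole line.\<close>
    define h where "h s = ennreal \<bar>indicator {0<..<T} s * \<rho> x s\<bar>" for s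
    have int': "integrable lebesgue (\<lambda>s. indicator {0<..<T} s * \<rho> x s)"
      using int by (simp add: set_integrable_def)
    have h: "h \<in> borel_measurable lebesgue"
      unfolding h_def[abs_def] using borel_measurable_integrable[OF int'] by simp
    have "ennreal \<bar>u T x - U M x\<bar> \<le> (\<integral>\<^sup>+s. h s \<partial>lebesgue)"
      using integral_norm_bound_ennreal[OF int'] by (simp add: eq set_lebesgue_integral_def h_def)
    also have "\<dots> = integral\<^sup>N (lebesgue_on {0<..<T}) h"
      by (subst nn_integral_restrict_space) (auto intro!: nn_integral_cong simp: h_def indicator_def)
    also have "\<dots> \<le> (\<Sum>j=1..M. integral\<^sup>N (lebesgue_on {t (j - 1)<..<t j}) h)"
      by (rule nn_integral_le_sum_over_mesh[OF mesh h])
    also have "\<dots> \<le> (\<Sum>j=1..M. ennreal (exp (- \<gamma> * (T - t j))) *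
        (eta_f \<Omega> (\<kappa> 0) t f j + eta_d2U \<Omega> L (\<kappa> 0) t f U j))"
    proof (rule sum_mono)
      fix j assume j: "j \<in> {1..M}"
      let ?I = "{t (j - 1)<..<t j}"
      have "h s \<le> ennreal \<bar>\<rho> x s\<bar>" for s by (simp add: h_def indicator_def)
      then have "AE s in lebesgue_on ?I. h s \<le> ennreal (C j) * (F j s + ennreal (t j - s) * N j)"
        using \<rho>_bound[OF x j] by (auto elim!: eventually_mono intro: order_trans)
      then have "integral\<^sup>N (lebesgue_on ?I) h
          \<le> ennreal (C j) * (integral\<^sup>N (lebesgue_on ?I) (F j) + ennreal ((t j - t (j - 1))\<^sup>2 / 2) * N j)"
        using h C mesh_step_pos[OF mesh j]
        by (intro nn_integral_interval_bound measurable_restrict_space1) (auto simp: step_def)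
      also have "integral\<^sup>N (lebesgue_on ?I) (F j) = (\<integral>\<^sup>+s\<in>?I. F j s \<partial>lebesgue)"
        by (simp add: nn_integral_restrict_space)
      also have "ennreal (C j) * ((\<integral>\<^sup>+s\<in>?I. F j s \<partial>lebesgue) + ennreal ((t j - t (j - 1))\<^sup>2 / 2) * N j)
          = ennreal (exp (- \<gamma> * (T - t j))) * (eta_f \<Omega> (\<kappa> 0) t f j + eta_d2U \<Omega> L (\<kappa> 0) t f U j)"
      proof -
        have "ennreal (C j) = ennreal (exp (- \<gamma> * (T - t j))) * ennreal (\<kappa> 0)"
          using \<kappa> unfolding C_def by (subst ennreal_mult[symmetric]) (auto simp: mult.commute)
        moreover have "ennreal (\<kappa> 0 * (step t j)\<^sup>2 / 2) = ennreal (\<kappa> 0) * ennreal ((t j - t (j - 1))\<^sup>2 / 2)"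
          using \<kappa> by (subst ennreal_mult[symmetric]) (auto simp: step_def)
        ultimately show ?thesis
          unfolding eta_f_def eta_d2U_def F_def N_def
          by (simp only: distrib_left mult.assoc)
      qed
      finally show "integral\<^sup>N (lebesgue_on ?I) h \<le> ennreal (exp (- \<gamma> * (T - t j))) *
        (eta_f \<Omega> (\<kappa> 0) t f j + eta_d2U \<Omega> L (\<kappa> 0) t f U j)" .
    qed
    finally show ?thesis .
  qed
  have "(\<lambda>x. u T x - U M x) \<in> L2 \<Omega>"
    using U[of M] uH[of T] \<open>T > 0\<close> by (intro L2_diff H01_subset_L2) auto
  then have "(\<lambda>x. u T x - U M x) \<in> borel_measurable (lebesgue_on \<Omega>)"
    by (simp add: L2_def)
  then have "(\<lambda>x. ennreal \<bar>u T x - U M x\<bar>) \<in> borel_measurable (lebesgue_on \<Omega>)"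
    by measurable
  then show ?thesis
    unfolding Linf_norm_def
  proof (rule esssup_I)
    show "AE x in lebesgue_on \<Omega>. ennreal \<bar>u T x - U M x\<bar>
      \<le> (\<Sum>j=1..M. ennreal (exp (- \<gamma> * (T - t j))) * (eta_f \<Omega> (\<kappa> 0) t f j + eta_d2U \<Omega> L (\<kappa> 0) t f U j))"
      using rep AE_space
      by eventually_elim (rule bound, auto)
  qed
qed

end
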